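(* Let $0<a\le 1$, $b\ge 1$ with $ab>1$, and $P_1,P_2>0$. Consider the Gaussian interference channel with mixed interference $Y_1=X_1+bX_2+Z_1$, $Y_2=aX_1+X_2+Z_2$, with unit-variance Gaussian noises and input power constraints $P_1,P_2$. Let $\mathcal{R_N}$ be the noiseberg region (defined in the context) of the one-sided Gaussian interference channel $Y_1=X_1+Z_1$, $Y_2=aX_1+X_2+Z_2$ with the same power constraints, obtained by removing the interfering link with gain $b$. Then $\mathcal{R_N}$ is achievable for the mixed-interference channel.
   Context: Channel: two transmitters send independent messages $W_1,W_2$; receiver $k$ observes $Y_k$ and must decode $W_k$ ($k=1,2$). The inputs $X_1,X_2$ are real, subject to average power constraints $P_1,P_2$ over the block; $Z_1,Z_2$ are Gaussian noises of unit variance, independent of the inputs and i.i.d. over time; the transmitters do not cooperate. A rate pair is achievable in the usual sense (codes of these rates with error probability tending to $0$ as block length tends to infinity); the capacity region is the closure of the set of achievable pairs, and a region is called achievable if it is contained in the capacity region. Rates are per real channel use, in units matching the fixed base of $\log$. Throughout $\bar\lambda=1-\lambda$. Noiseberg region $\mathcal{R_N}$ (depends only on $a,P_1,P_2$). For parameters $0\le\lambda<1$ and $h\ge 0$, put $$\frac{P_{1A}}{\bar\lambda}=P_1-\frac{P_2\lambda}{a^2\bar\lambda}-\lambda\min\Big\{h,\frac{1-a^2}{a^2}\Big\}-\max\Big\{0,h-\frac{1-a^2}{a^2}\Big\},$$ $$\frac{P_{1B}}{\lambda}=P_1+\frac{P_2}{a^2}+\bar\lambda\min\Big\{h,\frac{1-a^2}{a^2}\Big\},\qquad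 \frac{P_{1C}}{\bar\lambda}=\max\Big\{0,h-\frac{1-a^2}{a^2}\Big\}$$ (so $P_{1A}+P_{1B}+P_{1C}=P_1$). The pair $(\lambda,h)$ is admissible if $P_{1A}\ge 0$. $\mathcal{R_N}$ is the set of all nonnegative pairs $(R_1,R_2)$ for which there is an admissible $(\lambda,h)$ with $$R_1\le \bar\lambda R_{1\bar\lambda}+\lambda R_{1\lambda},\qquad R_2\le\bar\lambda R_{2\bar\lambda}$$ for some nonnegative $R_{1\bar\lambda},R_{2\bar\lambda},R_{1\lambda}$ satisfying $$R_{1\bar\lambda}\le\tfrac12\log\Big(1+\frac{P_{1A}}{\bar\lambda}\Big)+\tfrac12\log\left(1+\frac{a^2P_{1C}/\bar\lambda}{1+a^2P_{1A}/\bar\lambda+P_2/\bar\lambda}\right),$$ $$R_{2\bar\lambda}\le\tfrac12\log\left(1+\frac{P_2/\bar\lambda}{1+a^2P_{1A}/\bar\lambda}\right),\qquad R_{1\lambda}\le\tfrac12\log\Big(1+\frac{P_{1B}}{\lambda}\Big),$$ where for $\lambda=0$ the ratio $P_{1B}/\lambda$ is read as the value given by its formula and $P_{1B}=0$ (so the term $\lambda R_{1\lambda}$ vanishes). *)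

theory Defs
  imports "HOL-Probability.Probability"
begin

section \<open>Two-user Gaussian interference channel in standard form\<close>

text \<open>
  The channel with gains \<open>a\<close>, \<open>b\<close> is \<open>Y1 = X1 + b X2 + Z1\<close>, \<open>Y2 = a X1 + X2 + Z2\<close>.
  Message \<open>w\<close> of transmitter \<open>k\<close> is sent as the codeword \<open>enc k w 0, ..., enc k w (n - 1)\<close>; the
  encoders do not cooperate. Received blocks are elements of the product space over \<open>{..<n}\<close>.
\<close>

record ic_code =
  enc1 :: "nat \<Rightarrow> nat \<Rightarrow> real"
  enc2 :: "nat \<Rightarrow> nat \<Rightarrow> real"
  dec1 :: "(nat \<Rightarrow> real) \<Rightarrow> nat"
  dec2 :: "(nat \<Rightarrow> real) \<Rightarrow> nat"

definition num_messages :: "real \<Rightarrow> nat \<Rightarrow> real \<Rightarrow> nat" where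
  "num_messages \<beta> n R = nat \<lceil>\<beta> powr (real n * R)\<rceil>"

definition noise_measure :: "nat \<Rightarrow> (nat \<Rightarrow> real) measure" where
  "noise_measure n = PiM {..<n} (\<lambda>_. density lborel std_normal_density)"

text \<open>The power constraint is imposed on every codeword.\<close>

definition valid_ic_code :: "real \<Rightarrow> real \<Rightarrow> nat \<Rightarrow> nat \<Rightarrow> nat \<Rightarrow> ic_code \<Rightarrow> bool" where
  "valid_ic_code P1 P2 n M1 M2 C \<longleftrightarrow>
     (\<forall>w<M1. (\<Sum>i<n. (enc1 C w i)\<^sup>2) / real n \<le> P1) \<and>
     (\<forall>w<M2. (\<Sum>i<n. (enc2 C w i)\<^sup>2) / real n \<le> P2) \<and>
     dec1 C \<in> PiM {..<n} (\<lambda>_. borel) \<rightarrow>\<^sub>M count_space UNIV \<and>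
     dec2 C \<in> PiM {..<n} (\<lambda>_. borel) \<rightarrow>\<^sub>M count_space UNIV"

definition output1 :: "real \<Rightarrow> nat \<Rightarrow> ic_code \<Rightarrow> nat \<Rightarrow> nat \<Rightarrow> (nat \<Rightarrow> real) \<Rightarrow> nat \<Rightarrow> real" where
  "output1 b n C w1 w2 z = (\<lambda>i\<in>{..<n}. enc1 C w1 i + b * enc2 C w2 i + z i)"

definition output2 :: "real \<Rightarrow> nat \<Rightarrow> ic_code \<Rightarrow> nat \<Rightarrow> nat \<Rightarrow> (nat \<Rightarrow> real) \<Rightarrow> nat \<Rightarrow> real" where
  "output2 a n C w1 w2 z = (\<lambda>i\<in>{..<n}. a * enc1 C w1 i + enc2 C w2 i + z i)"

text \<open>
  Error probabilities of the two receivers for independent, uniformly distributed messages.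
  Each depends only on the law of the noise at that receiver, so the joint law of the two noises
  (arbitrarily correlated, in general) need not be specified.
\<close>

definition error_prob1 :: "real \<Rightarrow> nat \<Rightarrow> nat \<Rightarrow> nat \<Rightarrow> ic_code \<Rightarrow> real" where
  "error_prob1 b n M1 M2 C =
     (\<Sum>w1<M1. \<Sum>w2<M2. measure (noise_measure n)
        {z \<in> space (noise_measure n). dec1 C (output1 b n C w1 w2 z) \<noteq> w1})
     / (real M1 * real M2)"

definition error_prob2 :: "real \<Rightarrow> nat \<Rightarrow> nat \<Rightarrow> nat \<Rightarrow> ic_code \<Rightarrow> real" where
  "error_prob2 a n M1 M2 C =
     (\<Sum>w1<M1. \<Sum>w2<M2. measure (noise_measure n)
        {z \<in> space (noise_measure n). dec2 C (output2 a n C w1 w2 z) \<noteq> w2})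
     / (real M1 * real M2)"

text \<open>Here \<open>\<beta>\<close> is the base of the logarithm, which fixes the unit of rate.\<close>

definition achievable_rate_pair ::
  "real \<Rightarrow> real \<Rightarrow> real \<Rightarrow> real \<Rightarrow> real \<Rightarrow> real \<times> real \<Rightarrow> bool" where
  "achievable_rate_pair \<beta> a b P1 P2 = (\<lambda>(R1, R2).
     0 \<le> R1 \<and> 0 \<le> R2 \<and>
     (\<exists>C :: nat \<Rightarrow> ic_code.
        (\<forall>n. valid_ic_code P1 P2 n (num_messages \<beta> n R1) (num_messages \<beta> n R2) (C n)) \<and>
        (\<lambda>n. error_prob1 b n (num_messages \<beta> n R1) (num_messages \<beta> n R2) (C n)) \<longlonglongrightarrow> 0 \<and>
        (\<lambda>n. error_prob2 a n (num_messages \<beta> n R1) (num_messages \<beta> n R2) (C n)) \<longlonglongrightarrow> 0))"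

definition capacity_region ::
  "real \<Rightarrow> real \<Rightarrow> real \<Rightarrow> real \<Rightarrow> real \<Rightarrow> (real \<times> real) set" where
  "capacity_region \<beta> a b P1 P2 = closure {R. achievable_rate_pair \<beta> a b P1 P2 R}"

definition achievable_region ::
  "real \<Rightarrow> real \<Rightarrow> real \<Rightarrow> real \<Rightarrow> real \<Rightarrow> (real \<times> real) set \<Rightarrow> bool" where
  "achievable_region \<beta> a b P1 P2 S \<longleftrightarrow> S \<subseteq> capacity_region \<beta> a b P1 P2"

section \<open>The noiseberg region\<close>

text \<open>
  The functions \<open>dens_A\<close>, \<open>dens_B\<close>, \<open>dens_C\<close> are the ratios
  \<open>P1A / (1 - lam)\<close>, \<open>P1B / lam\<close>, \<open>P1C / (1 - lam)\<close>. Taking the ratios rather than the powers as primitive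
  avoids a division by zero in the second one at \<open>lam = 0\<close>. In \<open>noiseberg_region\<close>, \<open>r1\<close> and \<open>r2\<close>
  are the rates in the band of width \<open>1 - lam\<close>, and \<open>s1\<close> is the rate in the band of width \<open>lam\<close>.
\<close>

definition dens_A :: "real \<Rightarrow> real \<Rightarrow> real \<Rightarrow> real \<Rightarrow> real \<Rightarrow> real" where
  "dens_A a P1 P2 lam h = P1 - P2 * lam / (a\<^sup>2 * (1 - lam))
     - lam * min h ((1 - a\<^sup>2) / a\<^sup>2) - max 0 (h - (1 - a\<^sup>2) / a\<^sup>2)"

definition dens_B :: "real \<Rightarrow> real \<Rightarrow> real \<Rightarrow> real \<Rightarrow> real \<Rightarrow> real" where
  "dens_B a P1 P2 lam h = P1 + P2 / a\<^sup>2 + (1 - lam) * min h ((1 - a\<^sup>2) / a\<^sup>2)"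

definition dens_C :: "real \<Rightarrow> real \<Rightarrow> real" where
  "dens_C a h = max 0 (h - (1 - a\<^sup>2) / a\<^sup>2)"

lemma noiseberg_total_power:
  assumes "0 < a" "lam < 1"
  shows "(1 - lam) * dens_A a P1 P2 lam h + lam * dens_B a P1 P2 lam h + (1 - lam) * dens_C a h = P1"
proof -
  have "(1 - lam) * (P2 * lam / (a\<^sup>2 * (1 - lam))) = lam * (P2 / a\<^sup>2)"
    using assms by (simp add: field_simps)
  then show ?thesis
    unfolding dens_A_def dens_B_def dens_C_def by algebra
qed

definition noiseberg_admissible :: "real \<Rightarrow> real \<Rightarrow> real \<Rightarrow> real \<Rightarrow> real \<Rightarrow> bool" where
  "noiseberg_admissible a P1 P2 lam h \<longleftrightarrow>
     0 \<le> lam \<and> lam < 1 \<and> 0 \<le> h \<and> 0 \<le> (1 - lam) * dens_A a P1 P2 lam h"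

definition noiseberg_region :: "real \<Rightarrow> real \<Rightarrow> real \<Rightarrow> real \<Rightarrow> (real \<times> real) set" where
  "noiseberg_region \<beta> a P1 P2 = {(R1, R2). 0 \<le> R1 \<and> 0 \<le> R2 \<and>
     (\<exists>lam h. noiseberg_admissible a P1 P2 lam h \<and>
       (\<exists>r1 r2 s1. 0 \<le> r1 \<and> 0 \<le> r2 \<and> 0 \<le> s1 \<and>
          R1 \<le> (1 - lam) * r1 + lam * s1 \<and>
          R2 \<le> (1 - lam) * r2 \<and>
          r1 \<le> 1/2 * log \<beta> (1 + dens_A a P1 P2 lam h)
                + 1/2 * log \<beta> (1 + a\<^sup>2 * dens_C a h
                                   / (1 + a\<^sup>2 * dens_A a P1 P2 lam h + P2 / (1 - lam))) \<and>
          r2 \<le> 1/2 * log \<beta> (1 + (P2 / (1 - lam)) / (1 + a\<^sup>2 * dens_A a P1 P2 lam h)) \<and>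
          s1 \<le> 1/2 * log \<beta> (1 + dens_B a P1 P2 lam h)))}"

end

theory Submission
  imports Defs
begin

text \<open>
  Only the power split matters: transmitter 1 superposes a private layer of density \<open>A\<close> and a common
  layer of density \<open>C\<close> on the first band and sends a private layer of density \<open>B\<close> on the second one,
  while transmitter 2 uses the first band only, with density \<open>Q = P2 / (1 - lam)\<close>. The bands are
  realised by time sharing. Receiver 2 decodes the common layer and its own message, treating the private
  layer as noise; the two rates are then a corner point of its multiple-access region. Receiver 1
  decodes everything. Since \<open>a \<le> 1 \<le> b\<close> and \<open>a b > 1\<close>, each of its seven multiple-access
  constraints is implied by the rates used at receiver 2 and the rate of the private layer.

  Achievability of these constraints is proved by random coding with Gaussian codebooks. A single identity
  for the expectation of a product of Gaussian exponentials of linear forms gives the Chernoff bounds for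
  atypical noise and atypical power as well as the pairwise error exponent.
\<close>

section \<open>Gaussian exponentials of linear forms\<close>

text \<open>Write \<open>N = 1 + a\<^sup>2 * A\<close>. The rates used at receiver 2 are the
  logarithms of \<open>1 + a\<^sup>2 * C / (N + Q)\<close> and \<open>1 + Q / N\<close>, whose
  product telescopes to \<open>1 + (a\<^sup>2 * C + Q) / N\<close>. With the private layer regarded
  as noise, receiver 1 sees the common layer and transmitter 2 with relative gains
  \<open>1 / (1 + A)\<close> and \<open>b\<^sup>2 / (1 + A)\<close>, where receiver 2 has
  \<open>a\<^sup>2 / N\<close> and \<open>1 / N\<close>. Neither is smaller: the first because
  \<open>a \<le> 1\<close>, the second because \<open>b \<ge> 1\<close> and
  \<open>a * b > 1\<close>. So the interference arriving through \<open>b\<close> can be decoded and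
  removed without any loss against the one-sided channel.

  The private layer is one codebook stretching over both bands with slot-dependent amplitude; its
  rate is the average of the two band rates.

  Noiseberg points may use the full power and the full rates, but random codewords whose mean power
  equals the limit violate it with non-vanishing probability. All powers are therefore scaled by
  \<open>1 - \<eta>\<close> and the rates lowered accordingly; the closure in the capacity region
  recovers the boundary.\<close>

definition gauss :: "real measure" where
  "gauss = density lborel std_normal_density"

lemma sets_gauss [measurable_cong, simp]: "sets gauss = sets borel"
  and space_gauss [simp]: "space gauss = UNIV"
  by (simp_all add: gauss_def)

lemma prob_space_gauss: "prob_space gauss"
  unfolding gauss_def by (rule prob_space_normal_density) simp

lemma product_sigma_finite_gauss: "product_sigma_finite (\<lambda>_. gauss)"
  by unfold_locales (metis prob_space_gauss prob_space_imp_sigma_finite sigma_finite_measure.sigma_finite_countable)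

lemma nn_integral_normal_density:
  assumes "\<sigma> > 0"
  shows "(\<integral>\<^sup>+x. ennreal (normal_density \<mu> \<sigma> x) \<partial>lborel) = 1"
  using assms integral_normal_density[OF assms] integrable_normal_density[OF assms]
  by (subst nn_integral_eq_integral) auto

text \<open>Completing the square: the weighted standard density is a constant times another normal
  density. Negative \<open>p\<close> is allowed as long as the new precision stays positive; upper
  tail bounds rely on this.\<close>

lemma nn_integral_gauss_exp:
  assumes d: "1 + 2 * p * \<alpha>\<^sup>2 > 0"
  shows "(\<integral>\<^sup>+x. ennreal (exp (- p * (v - \<alpha> * x)\<^sup>2)) \<partial>gauss)
    = ennreal (1 / sqrt (1 + 2 * p * \<alpha>\<^sup>2) * exp (- p / (1 + 2 * p * \<alpha>\<^sup>2) * v\<^sup>2))"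
proof -
  define d where "d = 1 + 2 * p * \<alpha>\<^sup>2"
  define K where "K = 1 / sqrt d * exp (- p / d * v\<^sup>2)"
  \<comment> \<open>Precision \<open>d\<close> and mean \<open>\<mu>\<close> are read off from the
    quadratic \<open>- x\<^sup>2 / 2 - p * (v - \<alpha> * x)\<^sup>2\<close> in
    \<open>x\<close>.\<close>
  define \<mu> where "\<mu> = 2 * p * \<alpha> * v / d"
  have [simp]: "d > 0" "d \<noteq> 0" using d by (simp_all add: d_def)
  have "K \<ge> 0" by (simp add: K_def less_imp_le)
  have pt: "std_normal_density x * exp (- p * (v - \<alpha> * x)\<^sup>2)
     = K * normal_density \<mu> (1 / sqrt d) x" for x
  proof -
    have "- p / d * v\<^sup>2 + (- (x - \<mu>)\<^sup>2 / (2 * (1 / sqrt d)\<^sup>2)) = - x\<^sup>2 / 2 + - p * (v - \<alpha> * x)\<^sup>2"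
    proof -
      have "2 * d * (- p / d * v\<^sup>2 + (- (x - \<mu>)\<^sup>2 / (2 * (1 / sqrt d)\<^sup>2)))
        = - 2 * p * v\<^sup>2 - (d * x - d * \<mu>)\<^sup>2"
      proof -
        have sq: "(1 / sqrt d)\<^sup>2 = 1 / d" using \<open>d > 0\<close> by (simp add: power_divide less_imp_le)
        show ?thesis unfolding sq by (simp add: field_simps power2_eq_square)
      qed
      also have "d * \<mu> = 2 * p * \<alpha> * v"
        by (simp add: \<mu>_def)
      also have "- 2 * p * v\<^sup>2 - (d * x - 2 * p * \<alpha> * v)\<^sup>2
         = 2 * d * (- x\<^sup>2 / 2 + - p * (v - \<alpha> * x)\<^sup>2)"
        unfolding d_def by (simp add: field_simps power2_eq_square)
      finally show ?thesis by simp
    qed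
    then have "exp (- p / d * v\<^sup>2) * exp (- (x - \<mu>)\<^sup>2 / (2 * (1 / sqrt d)\<^sup>2))
       = exp (- x\<^sup>2 / 2) * exp (- p * (v - \<alpha> * x)\<^sup>2)"
      by (simp only: exp_add [symmetric])
    then show ?thesis
      by (simp add: normal_density_def K_def power_divide real_sqrt_divide real_sqrt_mult less_imp_le)
  qed
  have "(\<integral>\<^sup>+x. ennreal (exp (- p * (v - \<alpha> * x)\<^sup>2)) \<partial>gauss)
    = (\<integral>\<^sup>+x. ennreal (std_normal_density x * exp (- p * (v - \<alpha> * x)\<^sup>2)) \<partial>lborel)"
    unfolding gauss_def by (subst nn_integral_density) (auto simp: ennreal_mult)
  also have "\<dots> = (\<integral>\<^sup>+x. ennreal K * ennreal (normal_density \<mu> (1 / sqrt d) x) \<partial>lborel)"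
    unfolding pt using \<open>K \<ge> 0\<close> by (simp add: ennreal_mult)
  also have "\<dots> = ennreal K"
    by (subst nn_integral_cmult) (auto simp: nn_integral_normal_density)
  finally show ?thesis unfolding K_def d_def .
qed

text \<open>The map \<open>sl\<close> assigns each coordinate to the one linear form containing it,
  so the forms share no coordinates and the integral factorises. The induction splits off one
  coordinate; its contribution merely shifts \<open>v\<close> at one slot, which is why
  \<open>v\<close> must stay arbitrary.\<close>

lemma nn_integral_PiM_gauss_exp:
  fixes \<alpha> :: "'j \<Rightarrow> real" and sl :: "'j \<Rightarrow> 'i" and p v :: "'i \<Rightarrow> real"
  assumes "finite J" and "finite A" and "sl ` J \<subseteq> A"
    and "\<And>i. i \<in> A \<Longrightarrow> 1 + 2 * p i * (\<Sum>j | j \<in> J \<and> sl j = i. (\<alpha> j)\<^sup>2) > 0"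
  shows "(\<integral>\<^sup>+\<omega>. ennreal (\<Prod>i\<in>A. exp (- p i * (v i - (\<Sum>j | j \<in> J \<and> sl j = i. \<alpha> j * \<omega> j))\<^sup>2))
            \<partial>PiM J (\<lambda>_. gauss))
    = ennreal (\<Prod>i\<in>A. 1 / sqrt (1 + 2 * p i * (\<Sum>j | j \<in> J \<and> sl j = i. (\<alpha> j)\<^sup>2))
        * exp (- p i / (1 + 2 * p i * (\<Sum>j | j \<in> J \<and> sl j = i. (\<alpha> j)\<^sup>2)) * (v i)\<^sup>2))"
  using assms(1,3,4)
proof (induction J arbitrary: v rule: finite_induct)
  case empty
  interpret product_sigma_finite "\<lambda>_::'j. gauss" by (rule product_sigma_finite_gauss)
  show ?case by (simp add: PiM_empty)
next
  case (insert j0 J)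
  interpret product_sigma_finite "\<lambda>_::'j. gauss" by (rule product_sigma_finite_gauss)
  define i0 where "i0 = sl j0"
  define s where "s i = (\<Sum>j | j \<in> J \<and> sl j = i. (\<alpha> j)\<^sup>2)" for i
  define d where "d i = 1 + 2 * p i * s i" for i
  have i0: "i0 \<in> A" using insert.prems(1) by (simp add: i0_def)
  have fin [simp]: "finite {j. j \<in> J \<and> sl j = i}" for i
    using insert.hyps(1) by simp
  have set_eq: "{j. j \<in> insert j0 J \<and> sl j = i} =
      (if i = i0 then insert j0 {j. j \<in> J \<and> sl j = i} else {j. j \<in> J \<and> sl j = i})" for i
    by (auto simp: i0_def)
  have s_ins: "(\<Sum>j | j \<in> insert j0 J \<and> sl j = i. (\<alpha> j)\<^sup>2)
      = (if i = i0 then s i + (\<alpha> j0)\<^sup>2 else s i)" for i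
    unfolding set_eq using insert.hyps by (simp add: s_def)
  have l_ins: "(\<Sum>j | j \<in> insert j0 J \<and> sl j = i. \<alpha> j * (fun_upd \<omega> j0 y) j)
      = (if i = i0 then \<alpha> j0 * y else 0) + (\<Sum>j | j \<in> J \<and> sl j = i. \<alpha> j * \<omega> j)" for i \<omega> y
  proof -
    have "(\<Sum>j | j \<in> J \<and> sl j = i. \<alpha> j * (fun_upd \<omega> j0 y) j) = (\<Sum>j | j \<in> J \<and> sl j = i. \<alpha> j * \<omega> j)"
      using insert.hyps by (intro sum.cong) auto
    then show ?thesis
      unfolding set_eq using insert.hyps by (cases "i = i0") simp_all
  qed
  have s_nn: "s i \<ge> 0" for i unfolding s_def by (intro sum_nonneg) auto
  \<comment> \<open>The hypothesis concerns the sums that include \<open>j0\<close>. Without it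
    positivity persists: for \<open>p i \<ge> 0\<close> it is automatic, and for
    \<open>p i < 0\<close> dropping a square only increases the value.\<close>
  have d_pos: "d i > 0" if "i \<in> A" for i
  proof (cases "p i \<ge> 0")
    case True then show ?thesis using s_nn[of i] by (simp add: d_def add_pos_nonneg)
  next
    case False
    then have "2 * p i * (\<alpha> j0)\<^sup>2 \<le> 0" by (simp add: mult_nonpos_nonneg)
    then show ?thesis using insert.prems(2)[OF that] unfolding s_ins d_def
      by (auto simp: algebra_simps split: if_splits)
  qed
  have d0: "d i0 + 2 * p i0 * (\<alpha> j0)\<^sup>2 > 0"
    using insert.prems(2)[OF i0] unfolding s_ins d_def by (simp add: algebra_simps)
  have IH: "(\<integral>\<^sup>+\<omega>. ennreal (\<Prod>i\<in>A. exp (- p i * (v i - (\<Sum>j | j \<in> J \<and> sl j = i. \<alpha> j * \<omega> j))\<^sup>2))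
            \<partial>PiM J (\<lambda>_. gauss))
     = ennreal (\<Prod>i\<in>A. 1 / sqrt (d i) * exp (- p i / d i * (v i)\<^sup>2))" for v
    using insert.IH[of v] insert.prems d_pos unfolding d_def s_def by auto
  have "(\<integral>\<^sup>+\<omega>. ennreal (\<Prod>i\<in>A. exp (- p i * (v i - (\<Sum>j | j \<in> insert j0 J \<and> sl j = i. \<alpha> j * \<omega> j))\<^sup>2))
            \<partial>PiM (insert j0 J) (\<lambda>_. gauss))
     = (\<integral>\<^sup>+y. \<integral>\<^sup>+\<omega>. ennreal (\<Prod>i\<in>A. exp (- p i * (v i - (\<Sum>j | j \<in> insert j0 J \<and> sl j = i.
            \<alpha> j * (fun_upd \<omega> j0 y) j))\<^sup>2)) \<partial>PiM J (\<lambda>_. gauss) \<partial>gauss)"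
    using insert.hyps by (intro product_nn_integral_insert_rev) auto
  also have "\<dots> = (\<integral>\<^sup>+y. \<integral>\<^sup>+\<omega>. ennreal (\<Prod>i\<in>A. exp (- p i * ((v i - (if i = i0 then \<alpha> j0 * y else 0))
         - (\<Sum>j | j \<in> J \<and> sl j = i. \<alpha> j * \<omega> j))\<^sup>2)) \<partial>PiM J (\<lambda>_. gauss) \<partial>gauss)"
    unfolding l_ins by (simp only: diff_diff_eq)
  also have "\<dots> = (\<integral>\<^sup>+y. ennreal (\<Prod>i\<in>A. 1 / sqrt (d i)
      * exp (- p i / d i * (v i - (if i = i0 then \<alpha> j0 * y else 0))\<^sup>2)) \<partial>gauss)"
    unfolding IH ..
  also have "\<dots> = (\<integral>\<^sup>+y. ennreal ((\<Prod>i\<in>A-{i0}. 1 / sqrt (d i) * exp (- p i / d i * (v i)\<^sup>2)) / sqrt (d i0))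
      * ennreal (exp (- (p i0 / d i0) * (v i0 - \<alpha> j0 * y)\<^sup>2)) \<partial>gauss)"
  proof (intro nn_integral_cong)
    fix y
    have "(\<Prod>i\<in>A. 1 / sqrt (d i) * exp (- p i / d i * (v i - (if i = i0 then \<alpha> j0 * y else 0))\<^sup>2))
       = (1 / sqrt (d i0) * exp (- p i0 / d i0 * (v i0 - \<alpha> j0 * y)\<^sup>2))
         * (\<Prod>i\<in>A-{i0}. 1 / sqrt (d i) * exp (- p i / d i * (v i)\<^sup>2))"
      using assms(2) i0 by (subst prod.remove[of A i0]) (auto intro!: prod.cong)
    then show "ennreal (\<Prod>i\<in>A. 1 / sqrt (d i) * exp (- p i / d i * (v i - (if i = i0 then \<alpha> j0 * y else 0))\<^sup>2))
      = ennreal ((\<Prod>i\<in>A-{i0}. 1 / sqrt (d i) * exp (- p i / d i * (v i)\<^sup>2)) / sqrt (d i0))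
      * ennreal (exp (- (p i0 / d i0) * (v i0 - \<alpha> j0 * y)\<^sup>2))"
      by (subst ennreal_mult[symmetric])
        (auto intro!: divide_nonneg_nonneg prod_nonneg simp: less_imp_le d_pos i0 mult_ac)
  qed
  also have "\<dots> = ennreal ((\<Prod>i\<in>A-{i0}. 1 / sqrt (d i) * exp (- p i / d i * (v i)\<^sup>2)) / sqrt (d i0))
     * (\<integral>\<^sup>+y. ennreal (exp (- (p i0 / d i0) * (v i0 - \<alpha> j0 * y)\<^sup>2)) \<partial>gauss)"
    by (rule nn_integral_cmult) auto
  also have "(\<integral>\<^sup>+y. ennreal (exp (- (p i0 / d i0) * (v i0 - \<alpha> j0 * y)\<^sup>2)) \<partial>gauss)
     = ennreal (1 / sqrt (1 + 2 * (p i0 / d i0) * (\<alpha> j0)\<^sup>2)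
         * exp (- (p i0 / d i0) / (1 + 2 * (p i0 / d i0) * (\<alpha> j0)\<^sup>2) * (v i0)\<^sup>2))"
  proof (rule nn_integral_gauss_exp)
    have "(d i0 + 2 * p i0 * (\<alpha> j0)\<^sup>2) / d i0 > 0" using d0 d_pos[OF i0] by simp
    then show "1 + 2 * (p i0 / d i0) * (\<alpha> j0)\<^sup>2 > 0"
      using d_pos[OF i0] by (simp add: field_simps)
  qed
  \<comment> \<open>The two integrations compose: the weight \<open>p / d\<close> left by the inner
    one turns into \<open>p / (d + 2 * p * \<alpha>\<^sup>2)\<close>.\<close>
  also have "1 + 2 * (p i0 / d i0) * (\<alpha> j0)\<^sup>2 = (d i0 + 2 * p i0 * (\<alpha> j0)\<^sup>2) / d i0"
    using d_pos[OF i0] by (simp add: field_simps)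
  also have "d i0 + 2 * p i0 * (\<alpha> j0)\<^sup>2 = 1 + 2 * p i0 * (s i0 + (\<alpha> j0)\<^sup>2)"
    by (simp add: d_def algebra_simps)
  finally have *: "(\<integral>\<^sup>+\<omega>. ennreal (\<Prod>i\<in>A. exp (- p i * (v i - (\<Sum>j | j \<in> insert j0 J \<and> sl j = i. \<alpha> j * \<omega> j))\<^sup>2))
            \<partial>PiM (insert j0 J) (\<lambda>_. gauss))
     = ennreal ((\<Prod>i\<in>A-{i0}. 1 / sqrt (d i) * exp (- p i / d i * (v i)\<^sup>2)) / sqrt (d i0))
     * ennreal (1 / sqrt ((1 + 2 * p i0 * (s i0 + (\<alpha> j0)\<^sup>2)) / d i0)
         * exp (- (p i0 / d i0) / ((1 + 2 * p i0 * (s i0 + (\<alpha> j0)\<^sup>2)) / d i0) * (v i0)\<^sup>2))" .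
  define X where "X = 1 / sqrt ((1 + 2 * p i0 * (s i0 + (\<alpha> j0)\<^sup>2)) / d i0)
         * exp (- (p i0 / d i0) / ((1 + 2 * p i0 * (s i0 + (\<alpha> j0)\<^sup>2)) / d i0) * (v i0)\<^sup>2)"
  define P where "P = (\<Prod>i\<in>A-{i0}. 1 / sqrt (d i) * exp (- p i / d i * (v i)\<^sup>2))"
  have "X \<ge> 0" "P / sqrt (d i0) \<ge> 0"
    using d_pos[OF i0] d0 d_pos unfolding X_def P_def d_def
    by (auto intro!: divide_nonneg_nonneg prod_nonneg simp: less_imp_le algebra_simps)
  have eqX: "X / sqrt (d i0) = 1 / sqrt (1 + 2 * p i0 * (s i0 + (\<alpha> j0)\<^sup>2))
         * exp (- p i0 / (1 + 2 * p i0 * (s i0 + (\<alpha> j0)\<^sup>2)) * (v i0)\<^sup>2)"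
    using d_pos[OF i0] unfolding X_def by (simp add: real_sqrt_divide)
  have eqP: "P = (\<Prod>i\<in>A-{i0}. 1 / sqrt (1 + 2 * p i * (if i = i0 then s i + (\<alpha> j0)\<^sup>2 else s i))
        * exp (- p i / (1 + 2 * p i * (if i = i0 then s i + (\<alpha> j0)\<^sup>2 else s i)) * (v i)\<^sup>2))"
    unfolding P_def by (intro prod.cong) (auto simp: d_def)
  have "(\<Prod>i\<in>A. 1 / sqrt (1 + 2 * p i * (if i = i0 then s i + (\<alpha> j0)\<^sup>2 else s i))
        * exp (- p i / (1 + 2 * p i * (if i = i0 then s i + (\<alpha> j0)\<^sup>2 else s i)) * (v i)\<^sup>2))
      = X / sqrt (d i0) * P"
    unfolding eqX eqP using i0 assms(2) by (subst prod.remove[of A i0]) simp_all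
  also have "\<dots> = P / sqrt (d i0) * X" by simp
  finally show ?case
    unfolding * s_ins X_def[symmetric] P_def[symmetric]
    using \<open>X \<ge> 0\<close> \<open>P / sqrt (d i0) \<ge> 0\<close> by (simp only: ennreal_mult)
qed

section \<open>Superposed codewords and typicality\<close>

text \<open>
  A codebook is an array \<open>c (k, m, i)\<close> of independent standard Gaussians, with \<open>k\<close> a layer, \<open>m\<close> a
  message and \<open>i\<close> a time slot; \<open>w k\<close> is the message sent on layer \<open>k\<close>. In the end \<open>k = 0\<close> is the private
  and \<open>k = 1\<close> the common layer of transmitter 1, \<open>k = 2\<close> is transmitter 2, and \<open>k = 3\<close> is the receiver
  noise, seen as a layer with a single message.
\<close>

definition mixture :: "(nat \<Rightarrow> nat \<Rightarrow> real) \<Rightarrow> nat set \<Rightarrow> (nat \<Rightarrow> nat) \<Rightarrow> (nat \<times> nat \<times> nat \<Rightarrow> real) \<Rightarrow> nat \<Rightarrow> real" where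
  "mixture g T w c i = (\<Sum>k\<in>T. g k i * c (k, w k, i))"

text \<open>The variance of \<open>mixture g T w c i\<close> when the entries of \<open>c\<close>
  are independent standard Gaussians.\<close>

definition mixture_power :: "(nat \<Rightarrow> nat \<Rightarrow> real) \<Rightarrow> nat set \<Rightarrow> nat \<Rightarrow> real" where
  "mixture_power g T i = (\<Sum>k\<in>T. (g k i)\<^sup>2)"

text \<open>
  \<open>D\<close> are the layers to be decoded and \<open>E\<close> the layers treated as noise. Besides a small residual, the
  test requires that no partial cancellation leaves an atypically small remainder. This second condition
  yields the exponent \<open>1/2 ln (1 + S/N)\<close>; a test of the residual alone would not.
\<close>

definition plausible :: "(nat \<Rightarrow> nat \<Rightarrow> real) \<Rightarrow> nat set \<Rightarrow> nat set \<Rightarrow> nat \<Rightarrow> real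
    \<Rightarrow> (nat \<times> nat \<times> nat \<Rightarrow> real) \<Rightarrow> (nat \<Rightarrow> nat) \<Rightarrow> (nat \<Rightarrow> real) \<Rightarrow> bool" where
  "plausible g D E n \<delta> c w y \<longleftrightarrow>
     (\<Sum>i<n. (y i - mixture g D w c i)\<^sup>2 / mixture_power g E i) \<le> real n * (1 + \<delta>) \<and>
     (\<forall>T\<in>Pow D. real n * (1 - \<delta>) \<le> (\<Sum>i<n. (y i - mixture g (D - T) w c i)\<^sup>2 / mixture_power g (E \<union> T) i))"

lemma mixture_power_nonneg [simp]: "mixture_power g T i \<ge> 0"
  unfolding mixture_power_def by (intro sum_nonneg) auto

lemma mixture_power_Un: "finite S \<Longrightarrow> finite T \<Longrightarrow> S \<inter> T = {} \<Longrightarrow> mixture_power g (S \<union> T) i = mixture_power g S i + mixture_power g T i"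
  unfolding mixture_power_def by (rule sum.union_disjoint)

lemma mixture_Un: "finite S \<Longrightarrow> finite T \<Longrightarrow> S \<inter> T = {} \<Longrightarrow> mixture g (S \<union> T) w c i = mixture g S w c i + mixture g T w c i"
  unfolding mixture_def by (rule sum.union_disjoint)

lemma mixture_cong: "(\<And>k. k \<in> T \<Longrightarrow> w k = w' k) \<Longrightarrow> mixture g T w c i = mixture g T w' c i"
  unfolding mixture_def by (intro sum.cong) auto

lemma plausible_cong: "(\<And>k. k \<in> D \<Longrightarrow> w k = w' k) \<Longrightarrow> plausible g D E n \<delta> c w y = plausible g D E n \<delta> c w' y"
proof -
  assume "\<And>k. k \<in> D \<Longrightarrow> w k = w' k"
  then have "mixture g D w c i = mixture g D w' c i" "mixture g (D - T) w c i = mixture g (D - T) w' c i" for T i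
    by (auto intro!: mixture_cong)
  then show ?thesis unfolding plausible_def by simp
qed

lemma measurable_mixture:
  assumes "\<And>k. k \<in> T \<Longrightarrow> (k, w k, i) \<in> I"
  shows "(\<lambda>\<omega>. mixture g T w \<omega> i) \<in> borel_measurable (PiM I (\<lambda>_. gauss))"
proof -
  have "(\<lambda>\<omega>. \<omega> (k, w k, i)) \<in> borel_measurable (PiM I (\<lambda>_. gauss))" if "k \<in> T" for k
    using measurable_component_singleton[OF assms[OF that], of "\<lambda>_. gauss"]
    by (simp cong: measurable_cong_sets)
  then show ?thesis
    unfolding mixture_def by (intro borel_measurable_sum borel_measurable_times) auto
qed

text \<open>Specialises the coordinate form: a coefficient vanishes on every codeword that
  \<open>w\<close> does not select, and the slot of an entry is its third component.\<close>

lemma nn_integral_mixture: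
  assumes I: "finite I" "I \<subseteq> UNIV \<times> UNIV \<times> {..<n}" and T: "finite T"
    and wI: "\<And>k i. k \<in> T \<Longrightarrow> i < n \<Longrightarrow> (k, w k, i) \<in> I"
    and pos: "\<And>i. i < n \<Longrightarrow> 1 + 2 * p i * mixture_power g T i > 0"
  shows "(\<integral>\<^sup>+\<omega>. ennreal (\<Prod>i<n. exp (- p i * (v i - mixture g T w \<omega> i)\<^sup>2)) \<partial>PiM I (\<lambda>_. gauss))
    = ennreal (\<Prod>i<n. 1 / sqrt (1 + 2 * p i * mixture_power g T i)
        * exp (- p i / (1 + 2 * p i * mixture_power g T i) * (v i)\<^sup>2))"
proof -
  define \<alpha> :: "nat \<times> nat \<times> nat \<Rightarrow> real"
    where "\<alpha> = (\<lambda>(k, x, i). if k \<in> T \<and> x = w k then g k i else 0)"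
  have restr: "(\<Sum>j | j \<in> I \<and> snd (snd j) = i. f j) = (\<Sum>k\<in>T. f (k, w k, i))"
    if "i < n" and "\<And>k x. \<not> (k \<in> T \<and> x = w k) \<Longrightarrow> f (k, x, i) = 0" for i and f :: "nat \<times> nat \<times> nat \<Rightarrow> real"
  proof -
    have "(\<Sum>j | j \<in> I \<and> snd (snd j) = i. f j) = (\<Sum>j\<in>(\<lambda>k. (k, w k, i)) ` T. f j)"
      using I that wI by (intro sum.mono_neutral_right) (auto simp: image_iff)
    also have "\<dots> = (\<Sum>k\<in>T. f (k, w k, i))"
      by (subst sum.reindex) (auto simp: inj_on_def)
    finally show ?thesis .
  qed
  have e: "(\<Sum>j | j \<in> I \<and> snd (snd j) = i. (\<alpha> j)\<^sup>2) = mixture_power g T i" if "i < n" for i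
    using that by (subst restr) (auto simp: \<alpha>_def mixture_power_def)
  have l: "(\<Sum>j | j \<in> I \<and> snd (snd j) = i. \<alpha> j * \<omega> j) = mixture g T w \<omega> i" if "i < n" for i \<omega>
    using that by (subst restr) (auto simp: \<alpha>_def mixture_def)
  have "(\<integral>\<^sup>+\<omega>. ennreal (\<Prod>i<n. exp (- p i * (v i - mixture g T w \<omega> i)\<^sup>2)) \<partial>PiM I (\<lambda>_. gauss))
    = (\<integral>\<^sup>+\<omega>. ennreal (\<Prod>i<n. exp (- p i * (v i - (\<Sum>j | j \<in> I \<and> snd (snd j) = i. \<alpha> j * \<omega> j))\<^sup>2)) \<partial>PiM I (\<lambda>_. gauss))"
    by (intro nn_integral_cong arg_cong[where f = ennreal] prod.cong) (auto simp: l)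
  also have "\<dots> = ennreal (\<Prod>i<n. 1 / sqrt (1 + 2 * p i * (\<Sum>j | j \<in> I \<and> snd (snd j) = i. (\<alpha> j)\<^sup>2))
        * exp (- p i / (1 + 2 * p i * (\<Sum>j | j \<in> I \<and> snd (snd j) = i. (\<alpha> j)\<^sup>2)) * (v i)\<^sup>2))"
    using I pos by (intro nn_integral_PiM_gauss_exp) (auto simp: e)
  also have "\<dots> = ennreal (\<Prod>i<n. 1 / sqrt (1 + 2 * p i * mixture_power g T i)
        * exp (- p i / (1 + 2 * p i * mixture_power g T i) * (v i)\<^sup>2))"
    by (intro arg_cong[where f = ennreal] prod.cong) (auto simp: e)
  finally show ?thesis .
qed

section \<open>Exponential tail bounds for the energy of a mixture\<close>

lemma chernoff_mixture:
  assumes I: "finite I" "I \<subseteq> UNIV \<times> UNIV \<times> {..<n}" and T: "finite T"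
    and wI: "\<And>k i. k \<in> T \<Longrightarrow> i < n \<Longrightarrow> (k, w k, i) \<in> I"
    and pos: "\<And>i. i < n \<Longrightarrow> 1 + 2 * p i * mixture_power g T i > 0"
  shows "emeasure (PiM I (\<lambda>_. gauss)) {\<omega> \<in> space (PiM I (\<lambda>_. gauss)). t \<le> (\<Sum>i<n. - p i * (mixture g T w \<omega> i)\<^sup>2)}
    \<le> ennreal (exp (- t) * (\<Prod>i<n. 1 / sqrt (1 + 2 * p i * mixture_power g T i)))" (is "emeasure ?M ?S \<le> _")
proof -
  have [measurable]: "(\<lambda>\<omega>. mixture g T w \<omega> i) \<in> borel_measurable ?M" if "i \<in> {..<n}" for i
    using that wI by (intro measurable_mixture) auto
  have "emeasure ?M ?S = (\<integral>\<^sup>+\<omega>. indicator ?S \<omega> \<partial>?M)"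
    by (subst nn_integral_indicator) auto
  also have "\<dots> \<le> (\<integral>\<^sup>+\<omega>. ennreal (exp (- t)) * ennreal (\<Prod>i<n. exp (- p i * (0 - mixture g T w \<omega> i)\<^sup>2)) \<partial>?M)"
  proof (intro nn_integral_mono)
    fix \<omega>
    have "exp (- t) * (\<Prod>i<n. exp (- p i * (0 - mixture g T w \<omega> i)\<^sup>2))
       = exp ((\<Sum>i<n. - p i * (mixture g T w \<omega> i)\<^sup>2) - t)"
      by (simp add: exp_sum[symmetric] exp_add[symmetric] sum_negf)
    then have "ennreal (exp (- t)) * ennreal (\<Prod>i<n. exp (- p i * (0 - mixture g T w \<omega> i)\<^sup>2))
       = ennreal (exp ((\<Sum>i<n. - p i * (mixture g T w \<omega> i)\<^sup>2) - t))"
      by (subst ennreal_mult[symmetric]) (auto intro: prod_nonneg)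
    moreover have "1 \<le> exp ((\<Sum>i<n. - p i * (mixture g T w \<omega> i)\<^sup>2) - t)" if "\<omega> \<in> ?S"
      using that by simp
    ultimately show "indicator ?S \<omega> \<le> ennreal (exp (- t)) * ennreal (\<Prod>i<n. exp (- p i * (0 - mixture g T w \<omega> i)\<^sup>2))"
      by (auto simp only: indicator_def ennreal_1[symmetric] intro!: ennreal_leI split: if_splits)
         auto
  qed
  also have "\<dots> = ennreal (exp (- t)) * (\<integral>\<^sup>+\<omega>. ennreal (\<Prod>i<n. exp (- p i * (0 - mixture g T w \<omega> i)\<^sup>2)) \<partial>?M)"
    by (rule nn_integral_cmult) measurable
  also have "\<dots> = ennreal (exp (- t)) * ennreal (\<Prod>i<n. 1 / sqrt (1 + 2 * p i * mixture_power g T i))"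
    using nn_integral_mixture[OF I T wI pos, where v = "\<lambda>_. 0"] by simp
  also have "\<dots> = ennreal (exp (- t) * (\<Prod>i<n. 1 / sqrt (1 + 2 * p i * mixture_power g T i)))"
    using pos by (subst ennreal_mult[symmetric]) (auto intro!: prod_nonneg simp: less_imp_le)
  finally show ?thesis .
qed

text \<open>The linear term is exact, so in the tail bounds it cancels against the mean energy and
  only a quadratic cost remains to be traded against the deviation.\<close>

lemma inverse_sqrt_upper:
  fixes x :: real
  assumes "0 \<le> x" "x \<le> 1 / 4"
  shows "1 / sqrt (1 - 2 * x) \<le> exp (x + 4 * x\<^sup>2)"
proof -
  have "- (2 * x) - 2 * (2 * x)\<^sup>2 \<le> ln (1 - 2 * x)"
    using assms by (intro ln_one_minus_pos_lower_bound) auto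
  then have "exp (- (2 * x) - 2 * (2 * x)\<^sup>2) \<le> 1 - 2 * x"
    using assms by (subst (asm) ln_ge_iff) auto
  also have "exp (- (2 * x) - 2 * (2 * x)\<^sup>2) = (exp (- (x + 4 * x\<^sup>2)))\<^sup>2"
    by (simp add: power2_eq_square mult_exp_exp algebra_simps)
  finally have "exp (- (x + 4 * x\<^sup>2)) \<le> sqrt (1 - 2 * x)"
    by (intro real_le_rsqrt)
  then have "1 / sqrt (1 - 2 * x) \<le> 1 / exp (- (x + 4 * x\<^sup>2))"
    using assms by (intro divide_left_mono) auto
  then show ?thesis by (simp only: exp_minus inverse_eq_divide) simp
qed

lemma inverse_sqrt_lower:
  fixes x :: real
  assumes "0 \<le> x" "x \<le> 1 / 2"
  shows "1 / sqrt (1 + 2 * x) \<le> exp (- x + 2 * x\<^sup>2)"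
proof -
  have "2 * x - (2 * x)\<^sup>2 \<le> ln (1 + 2 * x)"
    using assms by (intro ln_one_plus_pos_lower_bound) auto
  then have "exp (2 * x - (2 * x)\<^sup>2) \<le> 1 + 2 * x"
    using assms by (subst (asm) ln_ge_iff) auto
  also have "exp (2 * x - (2 * x)\<^sup>2) = (exp (- (- x + 2 * x\<^sup>2)))\<^sup>2"
    by (simp add: power2_eq_square mult_exp_exp algebra_simps)
  finally have "exp (- (- x + 2 * x\<^sup>2)) \<le> sqrt (1 + 2 * x)"
    by (intro real_le_rsqrt)
  then have "1 / sqrt (1 + 2 * x) \<le> 1 / exp (- (- x + 2 * x\<^sup>2))"
    using assms by (intro divide_left_mono) auto
  then show ?thesis by (simp only: exp_minus inverse_eq_divide) simp
qed

lemma upper_tail_mixture: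
  assumes I: "finite I" "I \<subseteq> UNIV \<times> UNIV \<times> {..<n}" and T: "finite T"
    and wI: "\<And>k i. k \<in> T \<Longrightarrow> i < n \<Longrightarrow> (k, w k, i) \<in> I"
    and pos: "\<And>i. i < n \<Longrightarrow> mixture_power g T i > 0" and \<delta>: "0 < \<delta>" "\<delta> \<le> 1"
  shows "emeasure (PiM I (\<lambda>_. gauss)) {\<omega> \<in> space (PiM I (\<lambda>_. gauss)).
      real n * (1 + \<delta>) \<le> (\<Sum>i<n. (mixture g T w \<omega> i)\<^sup>2 / mixture_power g T i)} \<le> ennreal (exp (- (real n * \<delta>\<^sup>2 / 16)))"
proof -
  \<comment> \<open>The exponent per slot is
    \<open>4 * \<theta>\<^sup>2 - \<theta> * \<delta>\<close>; this choice minimises it, with value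
    \<open>- \<delta>\<^sup>2 / 16\<close>.\<close>
  define \<theta> where "\<theta> = \<delta> / 8"
  have \<theta>: "0 < \<theta>" "\<theta> \<le> 1 / 4" using \<delta> by (auto simp: \<theta>_def)
  have "{\<omega> \<in> space (PiM I (\<lambda>_. gauss)). real n * (1 + \<delta>) \<le> (\<Sum>i<n. (mixture g T w \<omega> i)\<^sup>2 / mixture_power g T i)}
    = {\<omega> \<in> space (PiM I (\<lambda>_. gauss)). \<theta> * (real n * (1 + \<delta>)) \<le> (\<Sum>i<n. - (- \<theta> / mixture_power g T i) * (mixture g T w \<omega> i)\<^sup>2)}"
    using \<theta>(1) by (simp add: sum_distrib_left[symmetric] times_divide_eq_right[symmetric] del: times_divide_eq_right)
  also have "emeasure (PiM I (\<lambda>_. gauss)) \<dots> \<le> ennreal (exp (- (\<theta> * (real n * (1 + \<delta>))))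
      * (\<Prod>i<n. 1 / sqrt (1 + 2 * (- \<theta> / mixture_power g T i) * mixture_power g T i)))"
    using I T wI
  proof (rule chernoff_mixture)
    fix i assume "i < n"
    then show "1 + 2 * (- \<theta> / mixture_power g T i) * mixture_power g T i > 0" using pos[of i] \<theta> by simp
  qed
  also have "(\<Prod>i<n. 1 / sqrt (1 + 2 * (- \<theta> / mixture_power g T i) * mixture_power g T i)) = (\<Prod>i<n. 1 / sqrt (1 - 2 * \<theta>))"
  proof (rule prod.cong)
    fix i assume "i \<in> {..<n}"
    then have "1 + 2 * (- \<theta> / mixture_power g T i) * mixture_power g T i = 1 - 2 * \<theta>"
      using pos[of i] by simp
    then show "1 / sqrt (1 + 2 * (- \<theta> / mixture_power g T i) * mixture_power g T i) = 1 / sqrt (1 - 2 * \<theta>)" by simp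
  qed simp
  also have "ennreal (exp (- (\<theta> * (real n * (1 + \<delta>)))) * (\<Prod>i<n. 1 / sqrt (1 - 2 * \<theta>)))
     \<le> ennreal (exp (- (\<theta> * (real n * (1 + \<delta>)))) * (\<Prod>i<n. exp (\<theta> + 4 * \<theta>\<^sup>2)))"
    using \<theta> by (intro ennreal_leI mult_left_mono prod_mono conjI inverse_sqrt_upper) auto
  also have "exp (- (\<theta> * (real n * (1 + \<delta>)))) * (\<Prod>i<n. exp (\<theta> + 4 * \<theta>\<^sup>2))
     = exp (- (real n * \<delta>\<^sup>2 / 16))"
    by (simp add: exp_of_nat_mult[symmetric] exp_add[symmetric] \<theta>_def field_simps power2_eq_square)
  finally show ?thesis .
qed

lemma lower_tail_mixture:
  assumes I: "finite I" "I \<subseteq> UNIV \<times> UNIV \<times> {..<n}" and T: "finite T"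
    and wI: "\<And>k i. k \<in> T \<Longrightarrow> i < n \<Longrightarrow> (k, w k, i) \<in> I"
    and pos: "\<And>i. i < n \<Longrightarrow> mixture_power g T i > 0" and \<delta>: "0 < \<delta>" "\<delta> \<le> 1"
  shows "emeasure (PiM I (\<lambda>_. gauss)) {\<omega> \<in> space (PiM I (\<lambda>_. gauss)).
      (\<Sum>i<n. (mixture g T w \<omega> i)\<^sup>2 / mixture_power g T i) \<le> real n * (1 - \<delta>)} \<le> ennreal (exp (- (real n * \<delta>\<^sup>2 / 16)))"
proof -
  \<comment> \<open>Same value as for the upper tail. The exponent
    \<open>2 * \<theta>\<^sup>2 - \<theta> * \<delta>\<close> becomes
    \<open>- 3 * \<delta>\<^sup>2 / 32\<close>, which is weakened below so that both tails share one
    bound.\<close>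
  define \<theta> where "\<theta> = \<delta> / 8"
  have \<theta>: "0 < \<theta>" "\<theta> \<le> 1 / 2" using \<delta> by (auto simp: \<theta>_def)
  have "{\<omega> \<in> space (PiM I (\<lambda>_. gauss)). (\<Sum>i<n. (mixture g T w \<omega> i)\<^sup>2 / mixture_power g T i) \<le> real n * (1 - \<delta>)}
    = {\<omega> \<in> space (PiM I (\<lambda>_. gauss)). - (\<theta> * (real n * (1 - \<delta>))) \<le> (\<Sum>i<n. - (\<theta> / mixture_power g T i) * (mixture g T w \<omega> i)\<^sup>2)}"
    using \<theta>(1) by (simp add: sum_distrib_left[symmetric] sum_negf times_divide_eq_right[symmetric] del: times_divide_eq_right)
  also have "emeasure (PiM I (\<lambda>_. gauss)) \<dots> \<le> ennreal (exp (- (- (\<theta> * (real n * (1 - \<delta>)))))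
      * (\<Prod>i<n. 1 / sqrt (1 + 2 * (\<theta> / mixture_power g T i) * mixture_power g T i)))"
    using I T wI
  proof (rule chernoff_mixture)
    fix i assume "i < n"
    then show "1 + 2 * (\<theta> / mixture_power g T i) * mixture_power g T i > 0" using pos[of i] \<theta> by simp
  qed
  also have "(\<Prod>i<n. 1 / sqrt (1 + 2 * (\<theta> / mixture_power g T i) * mixture_power g T i)) = (\<Prod>i<n. 1 / sqrt (1 + 2 * \<theta>))"
  proof (rule prod.cong)
    fix i assume "i \<in> {..<n}"
    then have "1 + 2 * (\<theta> / mixture_power g T i) * mixture_power g T i = 1 + 2 * \<theta>"
      using pos[of i] by simp
    then show "1 / sqrt (1 + 2 * (\<theta> / mixture_power g T i) * mixture_power g T i) = 1 / sqrt (1 + 2 * \<theta>)" by simp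
  qed simp
  also have "ennreal (exp (- (- (\<theta> * (real n * (1 - \<delta>))))) * (\<Prod>i<n. 1 / sqrt (1 + 2 * \<theta>)))
     \<le> ennreal (exp (- (- (\<theta> * (real n * (1 - \<delta>))))) * (\<Prod>i<n. exp (- \<theta> + 2 * \<theta>\<^sup>2)))"
    using \<theta> by (intro ennreal_leI mult_left_mono prod_mono conjI inverse_sqrt_lower) auto
  also have "\<dots> \<le> ennreal (exp (- (real n * \<delta>\<^sup>2 / 16)))"
  proof (rule ennreal_leI)
    have "exp (- (- (\<theta> * (real n * (1 - \<delta>))))) * (\<Prod>i<n. exp (- \<theta> + 2 * \<theta>\<^sup>2))
      = exp (- (real n * \<delta>\<^sup>2 * (3 / 32)))"
      by (simp add: exp_of_nat_mult[symmetric] exp_add[symmetric] \<theta>_def field_simps power2_eq_square)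
    also have "\<dots> \<le> exp (- (real n * \<delta>\<^sup>2 / 16))"
      by (simp add: mult_nonneg_nonneg)
    finally show "exp (- (- (\<theta> * (real n * (1 - \<delta>))))) * (\<Prod>i<n. exp (- \<theta> + 2 * \<theta>\<^sup>2)) \<le> exp (- (real n * \<delta>\<^sup>2 / 16))" .
  qed
  finally show ?thesis .
qed

text \<open>The power constraint concerns the unnormalised energy, whose variance changes from slot
  to slot. One weight \<open>\<theta>\<close> serves all slots, and the second-order cost is a
  relative excess \<open>4 * \<theta> * L\<close> over the mean power, negligible for small
  \<open>\<theta>\<close>.\<close>

lemma power_tail_mixture:
  assumes I: "finite I" "I \<subseteq> UNIV \<times> UNIV \<times> {..<n}" and T: "finite T"
    and wI: "\<And>k i. k \<in> T \<Longrightarrow> i < n \<Longrightarrow> (k, w k, i) \<in> I"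
    and \<theta>: "0 < \<theta>" and L: "0 \<le> L" "\<And>i. i < n \<Longrightarrow> mixture_power g T i \<le> L" "\<theta> * L \<le> 1 / 4"
    and S: "(\<Sum>i<n. mixture_power g T i) \<le> S"
  shows "emeasure (PiM I (\<lambda>_. gauss)) {\<omega> \<in> space (PiM I (\<lambda>_. gauss)). t \<le> (\<Sum>i<n. (mixture g T w \<omega> i)\<^sup>2)}
     \<le> ennreal (exp (- \<theta> * t + \<theta> * (1 + 4 * \<theta> * L) * S))"
proof -
  have small: "\<theta> * mixture_power g T i \<le> 1 / 4" if "i < n" for i
    using L(2)[OF that] L(3) \<theta> mult_left_mono[of "mixture_power g T i" L \<theta>] by linarith
  have "{\<omega> \<in> space (PiM I (\<lambda>_. gauss)). t \<le> (\<Sum>i<n. (mixture g T w \<omega> i)\<^sup>2)}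
    = {\<omega> \<in> space (PiM I (\<lambda>_. gauss)). \<theta> * t \<le> (\<Sum>i<n. - (- \<theta>) * (mixture g T w \<omega> i)\<^sup>2)}"
    using \<theta>(1) by (simp add: sum_distrib_left[symmetric])
  also have "emeasure (PiM I (\<lambda>_. gauss)) \<dots> \<le> ennreal (exp (- (\<theta> * t))
      * (\<Prod>i<n. 1 / sqrt (1 + 2 * (- \<theta>) * mixture_power g T i)))"
    using I T wI
  proof (rule chernoff_mixture)
    fix i assume "i < n"
    then show "1 + 2 * (- \<theta>) * mixture_power g T i > 0" using small[of i] by simp
  qed
  also have "\<dots> \<le> ennreal (exp (- (\<theta> * t)) * (\<Prod>i<n. exp (\<theta> * mixture_power g T i + 4 * (\<theta> * mixture_power g T i)\<^sup>2)))"
  proof (intro ennreal_leI mult_left_mono prod_mono conjI)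
    fix i assume "i \<in> {..<n}"
    then show "1 / sqrt (1 + 2 * - \<theta> * mixture_power g T i) \<le> exp (\<theta> * mixture_power g T i + 4 * (\<theta> * mixture_power g T i)\<^sup>2)"
      using inverse_sqrt_upper[of "\<theta> * mixture_power g T i"] small[of i] \<theta> by (simp add: mult.assoc)
    show "0 \<le> 1 / sqrt (1 + 2 * - \<theta> * mixture_power g T i)"
      using small[of i] \<open>i \<in> {..<n}\<close> by simp
  qed simp
  also have "\<dots> \<le> ennreal (exp (- \<theta> * t + \<theta> * (1 + 4 * \<theta> * L) * S))"
  proof (rule ennreal_leI)
    have "0 \<le> (\<Sum>i<n. mixture_power g T i)" by (intro sum_nonneg) auto
    have "(\<Sum>i<n. \<theta> * mixture_power g T i + 4 * (\<theta> * mixture_power g T i)\<^sup>2) \<le> (\<Sum>i<n. \<theta> * (1 + 4 * \<theta> * L) * mixture_power g T i)"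
    proof (rule sum_mono)
      fix i assume "i \<in> {..<n}"
      then have "mixture_power g T i * mixture_power g T i \<le> L * mixture_power g T i"
        using L(2) by (intro mult_right_mono) auto
      then have "4 * \<theta>\<^sup>2 * (mixture_power g T i * mixture_power g T i) \<le> 4 * \<theta>\<^sup>2 * (L * mixture_power g T i)"
        by (intro mult_left_mono) auto
      then show "\<theta> * mixture_power g T i + 4 * (\<theta> * mixture_power g T i)\<^sup>2 \<le> \<theta> * (1 + 4 * \<theta> * L) * mixture_power g T i"
        by (simp add: power2_eq_square algebra_simps)
    qed
    also have "\<dots> = \<theta> * (1 + 4 * \<theta> * L) * (\<Sum>i<n. mixture_power g T i)"
      by (simp add: sum_distrib_left)
    also have "\<dots> \<le> \<theta> * (1 + 4 * \<theta> * L) * S"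
      using S \<theta> L(1) by (intro mult_left_mono) auto
    finally show "exp (- (\<theta> * t)) * (\<Prod>i<n. exp (\<theta> * mixture_power g T i + 4 * (\<theta> * mixture_power g T i)\<^sup>2))
      \<le> exp (- \<theta> * t + \<theta> * (1 + 4 * \<theta> * L) * S)"
      by (simp add: exp_sum[symmetric] exp_add[symmetric])
  qed
  finally show ?thesis .
qed

section \<open>Pairwise error exponent\<close>

lemma sets_plausible:
  assumes w: "\<And>k i. k \<in> D \<Longrightarrow> i < n \<Longrightarrow> (k, w k, i) \<in> I" and D: "finite D"
    and y: "\<And>i. i < n \<Longrightarrow> (\<lambda>\<omega>. y \<omega> i) \<in> borel_measurable (PiM I (\<lambda>_. gauss))"
  shows "{\<omega> \<in> space (PiM I (\<lambda>_. gauss)). plausible g D E n \<delta> \<omega> w (y \<omega>)} \<in> sets (PiM I (\<lambda>_. gauss))"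
proof -
  have [measurable]: "(\<lambda>\<omega>. mixture g D w \<omega> i) \<in> borel_measurable (PiM I (\<lambda>_. gauss))"
    "(\<lambda>\<omega>. mixture g (D - T) w \<omega> i) \<in> borel_measurable (PiM I (\<lambda>_. gauss))"
    if "i \<in> {..<n}" for i T
    using that w by (auto intro!: measurable_mixture)
  have [measurable]: "(\<lambda>\<omega>. y \<omega> i) \<in> borel_measurable (PiM I (\<lambda>_. gauss))" if "i \<in> {..<n}" for i
    using y that by auto
  have fin: "finite (Pow D)" using D by simp
  have 1: "Measurable.pred (PiM I (\<lambda>_. gauss)) (\<lambda>\<omega>. (\<Sum>i<n. (y \<omega> i - mixture g D w \<omega> i)\<^sup>2 / mixture_power g E i) \<le> real n * (1 + \<delta>))"
    by measurable
  have 2: "Measurable.pred (PiM I (\<lambda>_. gauss)) (\<lambda>\<omega>. \<forall>T\<in>Pow D. real n * (1 - \<delta>) \<le> (\<Sum>i<n. (y \<omega> i - mixture g (D - T) w \<omega> i)\<^sup>2 / mixture_power g (E \<union> T) i))"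
    by (rule pred_intros_finite(3)[OF fin]) measurable
  show ?thesis
    unfolding plausible_def using 1 2 by measurable
qed

text \<open>For the true messages each remainder in the test is exactly a mixture over
  \<open>E \<union> T\<close>, so its normalised energy concentrates at \<open>n\<close>. One upper
  tail and a lower tail for each \<open>T\<close> give the factor
  \<open>1 + 2 ^ card D\<close>.\<close>

lemma emeasure_not_plausible:
  assumes I: "finite I" "I \<subseteq> UNIV \<times> UNIV \<times> {..<n}" and DE: "finite D" "finite E" "D \<inter> E = {}"
    and wI: "\<And>k i. k \<in> D \<union> E \<Longrightarrow> i < n \<Longrightarrow> (k, w k, i) \<in> I"
    and pos: "\<And>i. i < n \<Longrightarrow> mixture_power g E i > 0" and \<delta>: "0 < \<delta>" "\<delta> \<le> 1"
  shows "emeasure (PiM I (\<lambda>_. gauss)) {\<omega> \<in> space (PiM I (\<lambda>_. gauss)).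
      \<not> plausible g D E n \<delta> \<omega> w (mixture g (D \<union> E) w \<omega>)}
    \<le> ennreal ((1 + 2 ^ card D) * exp (- (real n * \<delta>\<^sup>2 / 16)))" (is "emeasure ?M ?S \<le> _")
proof -
  define U where "U = {\<omega> \<in> space ?M. real n * (1 + \<delta>) \<le> (\<Sum>i<n. (mixture g E w \<omega> i)\<^sup>2 / mixture_power g E i)}"
  define L where "L T = {\<omega> \<in> space ?M. (\<Sum>i<n. (mixture g (E \<union> T) w \<omega> i)\<^sup>2 / mixture_power g (E \<union> T) i) \<le> real n * (1 - \<delta>)}" for T
  have m: "(\<lambda>\<omega>. mixture g T w \<omega> i) \<in> borel_measurable ?M" if "i \<in> {..<n}" "T \<subseteq> D \<union> E" for i T
    using that wI by (intro measurable_mixture) auto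
  have [measurable]: "U \<in> sets ?M" 
  proof -
    have [measurable]: "(\<lambda>\<omega>. mixture g E w \<omega> i) \<in> borel_measurable ?M" if "i \<in> {..<n}" for i
      using that m by auto
    show ?thesis unfolding U_def by measurable
  qed
  have [measurable]: "L T \<in> sets ?M" if "T \<in> Pow D" for T
  proof -
    have [measurable]: "(\<lambda>\<omega>. mixture g (E \<union> T) w \<omega> i) \<in> borel_measurable ?M" if "i \<in> {..<n}" for i
      using that \<open>T \<in> Pow D\<close> m[of i "E \<union> T"] by auto
    show ?thesis unfolding L_def by measurable
  qed
  have "?S \<subseteq> U \<union> (\<Union>T\<in>Pow D. L T)"
  proof
    fix \<omega> assume \<omega>: "\<omega> \<in> ?S"
    have r: "mixture g (D \<union> E) w \<omega> i - mixture g (D - T) w \<omega> i = mixture g (E \<union> T) w \<omega> i" if "T \<subseteq> D" for T i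
    proof -
      have "D \<union> E = (D - T) \<union> (E \<union> T)" using that by auto
      moreover have "mixture g ((D - T) \<union> (E \<union> T)) w \<omega> i = mixture g (D - T) w \<omega> i + mixture g (E \<union> T) w \<omega> i"
        using DE that by (intro mixture_Un) (auto intro: finite_subset)
      ultimately show ?thesis by simp
    qed
    have "mixture g (D \<union> E) w \<omega> i - mixture g D w \<omega> i = mixture g E w \<omega> i" for i
      using r[of "{}"] by simp
    with \<omega> r show "\<omega> \<in> U \<union> (\<Union>T\<in>Pow D. L T)"
      unfolding plausible_def U_def L_def by (force simp: not_le less_imp_le)
  qed
  then have "emeasure ?M ?S \<le> emeasure ?M (U \<union> (\<Union>T\<in>Pow D. L T))"
    using DE(1) by (intro emeasure_mono sets.Un sets.finite_UN) auto
  also have "\<dots> \<le> emeasure ?M U + emeasure ?M (\<Union>T\<in>Pow D. L T)"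
    using DE(1) by (intro emeasure_subadditive sets.finite_UN) auto
  also have "\<dots> \<le> emeasure ?M U + (\<Sum>T\<in>Pow D. emeasure ?M (L T))"
    using DE(1) by (intro add_left_mono emeasure_subadditive_finite) auto
  also have "\<dots> \<le> ennreal (exp (- (real n * \<delta>\<^sup>2 / 16))) + (\<Sum>T\<in>Pow D. ennreal (exp (- (real n * \<delta>\<^sup>2 / 16))))"
  proof (intro add_mono sum_mono)
    show "emeasure ?M U \<le> ennreal (exp (- (real n * \<delta>\<^sup>2 / 16)))"
      unfolding U_def using DE wI by (intro upper_tail_mixture I pos \<delta>) auto
    fix T assume T: "T \<in> Pow D"
    then have "finite T" "E \<inter> T = {}" using DE by (auto intro: finite_subset)
    then have "mixture_power g (E \<union> T) i > 0" if "i < n" for i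
      using pos[OF that] DE by (simp add: mixture_power_Un add_pos_nonneg)
    then show "emeasure ?M (L T) \<le> ennreal (exp (- (real n * \<delta>\<^sup>2 / 16)))"
      unfolding L_def using DE wI T \<open>finite T\<close> by (intro lower_tail_mixture I \<delta>) auto
  qed
  also have "\<dots> = ennreal ((1 + 2 ^ card D) * exp (- (real n * \<delta>\<^sup>2 / 16)))"
    using DE(1) by (simp add: card_Pow sum_ennreal ennreal_plus[symmetric] distrib_right del: ennreal_plus sum_constant)
      (simp add: card_Pow)
  finally show ?thesis .
qed

text \<open>
  Both parts of the test enter one exponential weight, with factors \<open>exp (- (V - U)\<^sup>2 / (2 N))\<close> and
  \<open>exp (V\<^sup>2 / (2 (N + S)))\<close>. Integrating out the wrong codewords \<open>U\<close> first leaves a constant, whatever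
  the value of \<open>V\<close>.
\<close>

lemma emeasure_confusion:
  assumes I: "finite I" "I \<subseteq> UNIV \<times> UNIV \<times> {..<n}" and DE: "finite D" "finite E" "D \<inter> E = {}"
    and wI: "\<And>k i. k \<in> D \<union> E \<Longrightarrow> i < n \<Longrightarrow> (k, w k, i) \<in> I"
    and wI': "\<And>k i. k \<in> D \<Longrightarrow> i < n \<Longrightarrow> (k, w' k, i) \<in> I"
    and T: "T \<subseteq> D" "\<And>k. k \<in> T \<Longrightarrow> w' k \<noteq> w k" "\<And>k. k \<in> D - T \<Longrightarrow> w' k = w k"
    and pos: "\<And>i. i < n \<Longrightarrow> mixture_power g E i > 0"
  shows "emeasure (PiM I (\<lambda>_. gauss)) {\<omega> \<in> space (PiM I (\<lambda>_. gauss)).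
      plausible g D E n \<delta> \<omega> w' (mixture g (D \<union> E) w \<omega>)}
    \<le> ennreal (exp (real n * \<delta>) * (\<Prod>i<n. 1 / sqrt (1 + mixture_power g T i / mixture_power g E i)))" (is "emeasure ?M ?S \<le> ennreal ?B")
proof -
  have finT: "finite T" and ET: "E \<inter> T = {}" using T(1) DE by (auto intro: finite_subset)
  \<comment> \<open>\<open>V\<close> is what remains once the correctly guessed layers are
    cancelled; \<open>U\<close> is what the wrong codewords subtract from it. The set
    \<open>J\<close> below contains the entries used by \<open>U\<close>. None of them occurs in
    \<open>V\<close>, because \<open>w'\<close> differs from \<open>w\<close> on \<open>T\<close>
    and \<open>T\<close> is disjoint from \<open>E\<close>; so \<open>V\<close> is constant while
    \<open>J\<close> is integrated out.\<close>
  define V where "V \<omega> i = mixture g (E \<union> T) w \<omega> i" for \<omega> i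
  define U where "U \<omega> i = mixture g T w' \<omega> i" for \<omega> i
  define J where "J = {j \<in> I. fst j \<in> T \<and> fst (snd j) = w' (fst j)}"
  have r: "mixture g (D \<union> E) w \<omega> i - mixture g (D - T) w' \<omega> i = V \<omega> i"
    "mixture g (D \<union> E) w \<omega> i - mixture g D w' \<omega> i = V \<omega> i - U \<omega> i" for \<omega> i
  proof -
    have "D \<union> E = (D - T) \<union> (E \<union> T)" "D = (D - T) \<union> T" using T by auto
    moreover have "mixture g ((D - T) \<union> (E \<union> T)) w \<omega> i = mixture g (D - T) w \<omega> i + mixture g (E \<union> T) w \<omega> i"
      using DE T finT by (intro mixture_Un) auto
    moreover have "mixture g ((D - T) \<union> T) w' \<omega> i = mixture g (D - T) w' \<omega> i + mixture g T w' \<omega> i"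
      using DE T finT by (intro mixture_Un) auto
    moreover have "mixture g (D - T) w' \<omega> i = mixture g (D - T) w \<omega> i"
      using T(3) by (rule mixture_cong)
    ultimately show "mixture g (D \<union> E) w \<omega> i - mixture g (D - T) w' \<omega> i = V \<omega> i"
      "mixture g (D \<union> E) w \<omega> i - mixture g D w' \<omega> i = V \<omega> i - U \<omega> i"
      unfolding V_def U_def by (metis add_diff_cancel_left', metis add_diff_cancel_left diff_diff_eq)
  qed
  have mV: "(\<lambda>\<omega>. V \<omega> i) \<in> borel_measurable ?M" and mU: "(\<lambda>\<omega>. U \<omega> i) \<in> borel_measurable ?M"
    if "i \<in> {..<n}" for i
    unfolding V_def U_def using that T(1) wI wI' by (auto intro!: measurable_mixture)
  note [measurable] = mV mU
  define F where "F \<omega> = exp (real n * \<delta>) * (\<Prod>i<n. exp ((V \<omega> i)\<^sup>2 / (2 * mixture_power g (E \<union> T) i)))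
     * (\<Prod>i<n. exp (- (1 / (2 * mixture_power g E i)) * (V \<omega> i - U \<omega> i)\<^sup>2))" for \<omega>
  have mF: "(\<lambda>\<omega>. ennreal (F \<omega>)) \<in> borel_measurable ?M"
    unfolding F_def by measurable
  have mS: "?S \<in> sets ?M"
    using wI wI' by (intro sets_plausible DE measurable_mixture) auto
  have "emeasure ?M ?S = (\<integral>\<^sup>+\<omega>. indicator ?S \<omega> \<partial>?M)"
    using mS by simp
  also have "\<dots> \<le> (\<integral>\<^sup>+\<omega>. ennreal (F \<omega>) \<partial>?M)"
  proof (intro nn_integral_mono)
    fix \<omega>
    have "1 \<le> F \<omega>" if "\<omega> \<in> ?S"
    proof -
      from that have g: "plausible g D E n \<delta> \<omega> w' (mixture g (D \<union> E) w \<omega>)" by simp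
      then have 1: "(\<Sum>i<n. (V \<omega> i - U \<omega> i)\<^sup>2 / mixture_power g E i) \<le> real n * (1 + \<delta>)"
        unfolding plausible_def r by blast
      from g have 2: "real n * (1 - \<delta>) \<le> (\<Sum>i<n. (V \<omega> i)\<^sup>2 / mixture_power g (E \<union> T) i)"
        using T(1) unfolding plausible_def r(1)[symmetric] by blast
      \<comment> \<open>The two tests contribute at least \<open>n * (1 - \<delta>) / 2 - n * (1 +
        \<delta>) / 2 = - n * \<delta>\<close> to the exponent, which the prefactor
        \<open>exp (n * \<delta>)\<close> compensates.\<close>
      have "F \<omega> = exp (real n * \<delta> + (\<Sum>i<n. (V \<omega> i)\<^sup>2 / mixture_power g (E \<union> T) i) / 2 - (\<Sum>i<n. (V \<omega> i - U \<omega> i)\<^sup>2 / mixture_power g E i) / 2)"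
        unfolding F_def by (simp add: exp_sum[symmetric] exp_add[symmetric] sum_negf sum_divide_distrib mult.commute)
      also have "\<dots> \<ge> 1" using 1 2 by (simp add: algebra_simps)
      finally show ?thesis .
    qed
    then show "indicator ?S \<omega> \<le> ennreal (F \<omega>)"
      by (auto simp only: indicator_def ennreal_1[symmetric] intro!: ennreal_leI split: if_splits) auto
  qed
  also have "\<dots> = (\<integral>\<^sup>+\<omega>. ennreal (F \<omega>) \<partial>PiM ((I - J) \<union> J) (\<lambda>_. gauss))"
    by (simp add: J_def Un_absorb2 subset_iff)
  also have "\<dots> = (\<integral>\<^sup>+x. \<integral>\<^sup>+y. ennreal (F (merge (I - J) J (x, y))) \<partial>PiM J (\<lambda>_. gauss) \<partial>PiM (I - J) (\<lambda>_. gauss))"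
  proof -
    interpret product_sigma_finite "\<lambda>_::nat \<times> nat \<times> nat. gauss" by (rule product_sigma_finite_gauss)
    have "I - J \<union> J = I" by (auto simp: J_def)
    then show ?thesis
      using I mF by (intro product_nn_integral_fold) (auto simp: J_def)
  qed
  also have "\<dots> = (\<integral>\<^sup>+x. ennreal ?B \<partial>PiM (I - J) (\<lambda>_. gauss))"
  proof (rule nn_integral_cong)
    fix x
    define v where "v i = V x i" for i
    have V: "V (merge (I - J) J (x, y)) i = v i" if "i < n" for y i
    proof -
      have "(k, w k, i) \<in> I - J" if "k \<in> E \<union> T" for k
        using that T wI \<open>i < n\<close> ET by (auto simp: J_def) (metis T(2))
      then show ?thesis unfolding V_def v_def mixture_def by (intro sum.cong) (auto simp: merge_def)
    qed
    have JU: "(k, w' k, i) \<in> J" if "k \<in> T" "i < n" for k i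
      using that T wI' by (auto simp: J_def)
    have U: "U (merge (I - J) J (x, y)) i = mixture g T w' y i" if "i < n" for y i
      unfolding U_def mixture_def using JU that by (intro sum.cong) (auto simp: merge_def)
    have "(\<integral>\<^sup>+y. ennreal (F (merge (I - J) J (x, y))) \<partial>PiM J (\<lambda>_. gauss))
      = (\<integral>\<^sup>+y. ennreal (exp (real n * \<delta>) * (\<Prod>i<n. exp ((v i)\<^sup>2 / (2 * mixture_power g (E \<union> T) i))))
         * ennreal (\<Prod>i<n. exp (- (1 / (2 * mixture_power g E i)) * (v i - mixture g T w' y i)\<^sup>2)) \<partial>PiM J (\<lambda>_. gauss))"
      unfolding F_def
      by (intro nn_integral_cong) (simp add: ennreal_mult[symmetric] prod_nonneg V U cong: prod.cong_simp)
    also have "\<dots> = ennreal (exp (real n * \<delta>) * (\<Prod>i<n. exp ((v i)\<^sup>2 / (2 * mixture_power g (E \<union> T) i))))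
         * (\<integral>\<^sup>+y. ennreal (\<Prod>i<n. exp (- (1 / (2 * mixture_power g E i)) * (v i - mixture g T w' y i)\<^sup>2)) \<partial>PiM J (\<lambda>_. gauss))"
    proof (rule nn_integral_cmult)
      have [measurable]: "(\<lambda>y. mixture g T w' y i) \<in> borel_measurable (PiM J (\<lambda>_. gauss))" if "i \<in> {..<n}" for i
        using that JU by (intro measurable_mixture) auto
      show "(\<lambda>y. ennreal (\<Prod>i<n. exp (- (1 / (2 * mixture_power g E i)) * (v i - mixture g T w' y i)\<^sup>2))) \<in> borel_measurable (PiM J (\<lambda>_. gauss))"
        by measurable
    qed
    also have "(\<integral>\<^sup>+y. ennreal (\<Prod>i<n. exp (- (1 / (2 * mixture_power g E i)) * (v i - mixture g T w' y i)\<^sup>2)) \<partial>PiM J (\<lambda>_. gauss))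
      = ennreal (\<Prod>i<n. 1 / sqrt (1 + 2 * (1 / (2 * mixture_power g E i)) * mixture_power g T i)
         * exp (- (1 / (2 * mixture_power g E i)) / (1 + 2 * (1 / (2 * mixture_power g E i)) * mixture_power g T i) * (v i)\<^sup>2))"
    proof (rule nn_integral_mixture)
      show "finite J" "J \<subseteq> UNIV \<times> UNIV \<times> {..<n}" using I by (auto simp: J_def)
      show "finite T" by (rule finT)
      show "(k, w' k, i) \<in> J" if "k \<in> T" "i < n" for k i using JU that .
      show "0 < 1 + 2 * (1 / (2 * mixture_power g E i)) * mixture_power g T i" if "i < n" for i
        using pos[OF that] by (intro add_pos_nonneg mult_nonneg_nonneg) auto
    qed
    also have "ennreal (exp (real n * \<delta>) * (\<Prod>i<n. exp ((v i)\<^sup>2 / (2 * mixture_power g (E \<union> T) i)))) * \<dots>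
      = ennreal (exp (real n * \<delta>) * (\<Prod>i<n. exp ((v i)\<^sup>2 / (2 * mixture_power g (E \<union> T) i)))
        * (\<Prod>i<n. 1 / sqrt (1 + 2 * (1 / (2 * mixture_power g E i)) * mixture_power g T i)
         * exp (- (1 / (2 * mixture_power g E i)) / (1 + 2 * (1 / (2 * mixture_power g E i)) * mixture_power g T i) * (v i)\<^sup>2)))"
      using pos by (intro ennreal_mult[symmetric] mult_nonneg_nonneg prod_nonneg ballI divide_nonneg_nonneg)
        (auto simp: less_imp_le add_pos_nonneg)
    also have "\<dots> = ennreal ?B"
    proof -
      have "exp ((v i)\<^sup>2 / (2 * mixture_power g (E \<union> T) i)) * (1 / sqrt (1 + 2 * (1 / (2 * mixture_power g E i)) * mixture_power g T i)
         * exp (- (1 / (2 * mixture_power g E i)) / (1 + 2 * (1 / (2 * mixture_power g E i)) * mixture_power g T i) * (v i)\<^sup>2))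
        = 1 / sqrt (1 + mixture_power g T i / mixture_power g E i)" if "i \<in> {..<n}" for i
      proof -
        have "mixture_power g E i > 0" using pos that by simp
        then have "mixture_power g E i + mixture_power g T i > 0" by (simp add: add_pos_nonneg)
        \<comment> \<open>With noise power \<open>N\<close> and wrong-layer power \<open>S\<close>,
          dividing \<open>1 / (2 * N)\<close> by \<open>1 + S / N\<close> gives
          \<open>1 / (2 * (N + S))\<close>. This is exactly the weight of \<open>V\<^sup>2\<close>
          in the other factor, so the dependence on \<open>V\<close> cancels.\<close>
        have "- (1 / (2 * mixture_power g E i)) / (1 + 2 * (1 / (2 * mixture_power g E i)) * mixture_power g T i) = - (1 / (2 * mixture_power g (E \<union> T) i))"
          using \<open>mixture_power g E i > 0\<close> \<open>mixture_power g E i + mixture_power g T i > 0\<close> DE(2) finT ET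
          by (simp add: mixture_power_Un field_simps)
        then show ?thesis by (simp add: mult_exp_exp)
      qed
      then show ?thesis
        by (simp only: mult.assoc prod.distrib[symmetric] cong: prod.cong)
    qed
    finally show "(\<integral>\<^sup>+y. ennreal (F (merge (I - J) J (x, y))) \<partial>PiM J (\<lambda>_. gauss)) = ennreal ?B" .
  qed
  also have "\<dots> = ennreal ?B"
  proof -
    interpret prob_space "PiM (I - J) (\<lambda>_. gauss)" by (rule prob_space_PiM) (rule prob_space_gauss)
    show ?thesis by (simp add: emeasure_space_1)
  qed
  finally show ?thesis .
qed

section \<open>Union bound\<close>

definition book_index :: "nat set \<Rightarrow> (nat \<Rightarrow> nat) \<Rightarrow> nat \<Rightarrow> (nat \<times> nat \<times> nat) set" where
  "book_index K M n = (SIGMA k:K. {..<M k} \<times> {..<n})"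

lemma finite_book_index: "finite K \<Longrightarrow> finite (book_index K M n)"
  unfolding book_index_def by (intro finite_SigmaI) auto

lemma mem_book_index [simp]: "(k, m, i) \<in> book_index K M n \<longleftrightarrow> k \<in> K \<and> m < M k \<and> i < n"
  by (auto simp: book_index_def)

lemma book_index_subset: "book_index K M n \<subseteq> UNIV \<times> UNIV \<times> {..<n}"
  by (auto simp: book_index_def)

text \<open>Larger than the event of a wrong output: any plausible wrong tuple counts, even one that
  is wrong only in a layer whose message the receiver does not want.\<close>

definition decoding_error :: "(nat \<Rightarrow> nat \<Rightarrow> real) \<Rightarrow> nat set \<Rightarrow> nat set \<Rightarrow> (nat \<Rightarrow> nat) \<Rightarrow> nat \<Rightarrow> real
    \<Rightarrow> (nat \<Rightarrow> nat) \<Rightarrow> (nat \<times> nat \<times> nat \<Rightarrow> real) \<Rightarrow> bool" where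
  "decoding_error g D E M n \<delta> w \<omega> \<longleftrightarrow>
     \<not> plausible g D E n \<delta> \<omega> w (mixture g (D \<union> E) w \<omega>) \<or>
     (\<exists>w'\<in>PiE D (\<lambda>k. {..<M k}). (\<exists>k\<in>D. w' k \<noteq> w k) \<and> plausible g D E n \<delta> \<omega> w' (mixture g (D \<union> E) w \<omega>))"

lemma sets_decoding_error:
  assumes DE: "finite D" "finite E" "D \<union> E \<subseteq> K" and w: "\<And>k. k \<in> D \<union> E \<Longrightarrow> w k < M k"
  shows "{\<omega> \<in> space (PiM (book_index K M n) (\<lambda>_. gauss)). decoding_error g D E M n \<delta> w \<omega>}
    \<in> sets (PiM (book_index K M n) (\<lambda>_. gauss))"
proof -
  let ?M = "PiM (book_index K M n) (\<lambda>_. gauss)"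
  have fin: "finite (PiE D (\<lambda>k. {..<M k}))" using DE by (intro finite_PiE) auto
  have g: "Measurable.pred ?M (\<lambda>\<omega>. plausible g D E n \<delta> \<omega> w' (mixture g (D \<union> E) w \<omega>))" if "\<And>k. k \<in> D \<Longrightarrow> w' k < M k" for w'
    unfolding pred_def using that DE w by (intro sets_plausible measurable_mixture) auto
  have 1: "Measurable.pred ?M (\<lambda>\<omega>. \<not> plausible g D E n \<delta> \<omega> w (mixture g (D \<union> E) w \<omega>))"
    using g[of w] w by auto
  have 2: "Measurable.pred ?M (\<lambda>\<omega>. \<exists>w'\<in>PiE D (\<lambda>k. {..<M k}). (\<exists>k\<in>D. w' k \<noteq> w k) \<and> plausible g D E n \<delta> \<omega> w' (mixture g (D \<union> E) w \<omega>))"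
    by (rule pred_intros_finite(4)[OF fin]) (use g in \<open>auto simp: PiE_def Pi_def\<close>)
  show ?thesis
    unfolding decoding_error_def using pred_intros_logic(5)[OF 1 2] unfolding pred_def by simp
qed

text \<open>Wrong tuples are grouped by the exact set \<open>T\<close> of layers in which they
  differ from \<open>w\<close>, since the pairwise bound depends on \<open>T\<close> alone.\<close>

lemma emeasure_decoding_error:
  assumes DE: "finite D" "finite E" "D \<inter> E = {}" "D \<union> E \<subseteq> K" and K: "finite K"
    and w: "\<And>k. k \<in> D \<union> E \<Longrightarrow> w k < M k"
    and pos: "\<And>i. i < n \<Longrightarrow> mixture_power g E i > 0" and \<delta>: "0 < \<delta>" "\<delta> \<le> 1"
  shows "emeasure (PiM (book_index K M n) (\<lambda>_. gauss))
      {\<omega> \<in> space (PiM (book_index K M n) (\<lambda>_. gauss)). decoding_error g D E M n \<delta> w \<omega>}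
    \<le> ennreal ((1 + 2 ^ card D) * exp (- (real n * \<delta>\<^sup>2 / 16)) +
        (\<Sum>T\<in>Pow D - {{}}. (\<Prod>k\<in>T. real (M k - 1)) *
           (exp (real n * \<delta>) * (\<Prod>i<n. 1 / sqrt (1 + mixture_power g T i / mixture_power g E i)))))"
    (is "emeasure ?M ?S \<le> ennreal (?a + (\<Sum>T\<in>_. _ * ?b T))")
proof -
  note I = finite_book_index[OF K, of M n] book_index_subset[of K M n]
  define G where "G w' = {\<omega> \<in> space ?M. plausible g D E n \<delta> \<omega> w' (mixture g (D \<union> E) w \<omega>)}" for w'
  define W where "W T = PiE D (\<lambda>k. if k \<in> T then {..<M k} - {w k} else {w k})" for T
  have W: "w' k < M k" if "w' \<in> W T" "k \<in> D" for w' T k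
    using PiE_mem[OF that[unfolded W_def]] w that by (auto split: if_splits)
  have finW: "finite (W T)" for T unfolding W_def using DE by (intro finite_PiE) auto
  have cardW: "real (card (W T)) = (\<Prod>k\<in>T. real (M k - 1))" if "T \<subseteq> D" for T
  proof -
    have "card (W T) = (\<Prod>k\<in>D. if k \<in> T then M k - 1 else 1)"
      unfolding W_def card_PiE[OF DE(1)] using w by (intro prod.cong) (auto simp: card_Diff_singleton)
    also have "\<dots> = (\<Prod>k\<in>T. M k - 1)"
      using that DE(1) by (simp add: prod.If_cases Int_absorb1 inf_commute Int_def[symmetric] Collect_mem_eq)
    finally show ?thesis by simp
  qed
  have [measurable]: "G w' \<in> sets ?M" if "\<And>k. k \<in> D \<Longrightarrow> w' k < M k" for w'
    unfolding G_def using that DE w by (intro sets_plausible measurable_mixture) auto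
  have b_nonneg: "?b T \<ge> 0" for T by (intro mult_nonneg_nonneg prod_nonneg) auto
  have nG: "{\<omega> \<in> space ?M. \<not> plausible g D E n \<delta> \<omega> w (mixture g (D \<union> E) w \<omega>)} \<in> sets ?M"
  proof -
    have "{\<omega> \<in> space ?M. \<not> plausible g D E n \<delta> \<omega> w (mixture g (D \<union> E) w \<omega>)} = space ?M - G w"
      by (auto simp: G_def)
    then show ?thesis using w by auto
  qed
  have U: "(\<Union>T\<in>Pow D - {{}}. \<Union>w'\<in>W T. G w') \<in> sets ?M"
    using DE(1) finW W by (intro sets.finite_UN) auto
  have "?S \<subseteq> {\<omega> \<in> space ?M. \<not> plausible g D E n \<delta> \<omega> w (mixture g (D \<union> E) w \<omega>)} \<union> (\<Union>T\<in>Pow D - {{}}. \<Union>w'\<in>W T. G w')"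
  proof
    fix \<omega> assume \<omega>: "\<omega> \<in> ?S"
    show "\<omega> \<in> {\<omega> \<in> space ?M. \<not> plausible g D E n \<delta> \<omega> w (mixture g (D \<union> E) w \<omega>)} \<union> (\<Union>T\<in>Pow D - {{}}. \<Union>w'\<in>W T. G w')"
    proof (cases "plausible g D E n \<delta> \<omega> w (mixture g (D \<union> E) w \<omega>)")
      case True
      then obtain w' where w': "w' \<in> PiE D (\<lambda>k. {..<M k})" "\<exists>k\<in>D. w' k \<noteq> w k" "\<omega> \<in> G w'"
        using \<omega> unfolding decoding_error_def G_def by auto
      define T where "T = {k \<in> D. w' k \<noteq> w k}"
      have "w' \<in> W T" using w'(1) unfolding W_def T_def by (auto simp: PiE_def Pi_def)
      moreover have "T \<in> Pow D - {{}}" using w'(2) by (auto simp: T_def)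
      ultimately show ?thesis using w'(3) by blast
    qed (use \<omega> in auto)
  qed
  then have "emeasure ?M ?S \<le> emeasure ?M ({\<omega> \<in> space ?M. \<not> plausible g D E n \<delta> \<omega> w (mixture g (D \<union> E) w \<omega>)} \<union> (\<Union>T\<in>Pow D - {{}}. \<Union>w'\<in>W T. G w'))"
    using nG U by (intro emeasure_mono sets.Un) auto
  also have "\<dots> \<le> emeasure ?M {\<omega> \<in> space ?M. \<not> plausible g D E n \<delta> \<omega> w (mixture g (D \<union> E) w \<omega>)} + emeasure ?M (\<Union>T\<in>Pow D - {{}}. \<Union>w'\<in>W T. G w')"
    using nG U by (intro emeasure_subadditive) auto
  also have "\<dots> \<le> ennreal ?a + (\<Sum>T\<in>Pow D - {{}}. ennreal ((\<Prod>k\<in>T. real (M k - 1)) * ?b T))"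
  proof (intro add_mono)
    show "emeasure ?M {\<omega> \<in> space ?M. \<not> plausible g D E n \<delta> \<omega> w (mixture g (D \<union> E) w \<omega>)} \<le> ennreal ?a"
      using DE w by (intro emeasure_not_plausible I pos \<delta>) auto
    have "emeasure ?M (\<Union>T\<in>Pow D - {{}}. \<Union>w'\<in>W T. G w') \<le> (\<Sum>T\<in>Pow D - {{}}. emeasure ?M (\<Union>w'\<in>W T. G w'))"
      using DE(1) finW W by (intro emeasure_subadditive_finite) (auto intro!: sets.finite_UN)
    also have "\<dots> \<le> (\<Sum>T\<in>Pow D - {{}}. ennreal ((\<Prod>k\<in>T. real (M k - 1)) * ?b T))"
    proof (rule sum_mono)
      fix T assume T: "T \<in> Pow D - {{}}"
      have "emeasure ?M (\<Union>w'\<in>W T. G w') \<le> (\<Sum>w'\<in>W T. emeasure ?M (G w'))"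
        using finW W by (intro emeasure_subadditive_finite) auto
      also have "\<dots> \<le> (\<Sum>w'\<in>W T. ennreal (?b T))"
      proof (rule sum_mono)
        fix w' assume w': "w' \<in> W T"
        then have "w' k \<in> (if k \<in> T then {..<M k} - {w k} else {w k})" if "k \<in> D" for k
          using that unfolding W_def by (rule PiE_mem)
        then have "w' k \<noteq> w k" if "k \<in> T" for k using that T by force
        moreover have "w' k = w k" if "k \<in> D - T" for k
          using \<open>\<And>k. k \<in> D \<Longrightarrow> _\<close>[of k] that by auto
        ultimately show "emeasure ?M (G w') \<le> ennreal (?b T)"
          unfolding G_def using DE w W[OF w'] T by (intro emeasure_confusion I pos) auto
      qed
      also have "\<dots> = ennreal ((\<Prod>k\<in>T. real (M k - 1)) * ?b T)"
        using T b_nonneg[of T] cardW[of T] by (simp add: ennreal_mult[symmetric] ennreal_of_nat_eq_real_of_nat del: of_nat_prod)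
      finally show "emeasure ?M (\<Union>w'\<in>W T. G w') \<le> ennreal ((\<Prod>k\<in>T. real (M k - 1)) * ?b T)" .
    qed
    finally show "emeasure ?M (\<Union>T\<in>Pow D - {{}}. \<Union>w'\<in>W T. G w') \<le> (\<Sum>T\<in>Pow D - {{}}. ennreal ((\<Prod>k\<in>T. real (M k - 1)) * ?b T))" .
  qed
  also have "\<dots> = ennreal (?a + (\<Sum>T\<in>Pow D - {{}}. (\<Prod>k\<in>T. real (M k - 1)) * ?b T))"
  proof -
    have "0 \<le> (\<Prod>k\<in>T. real (M k - 1)) * ?b T" for T
      using b_nonneg[of T] by (intro mult_nonneg_nonneg prod_nonneg) auto
    then show ?thesis
      by (subst sum_ennreal) (auto intro!: ennreal_plus[symmetric] sum_nonneg)
  qed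
  finally show ?thesis .
qed

section \<open>Derandomisation\<close>

lemma noise_measure_eq: "noise_measure n = PiM {..<n} (\<lambda>_. gauss)"
  unfolding noise_measure_def gauss_def ..

lemma mixture_cong_book:
  "(\<And>k. k \<in> T \<Longrightarrow> c (k, w k, i) = c' (k, w k, i)) \<Longrightarrow> mixture g T w c i = mixture g T w c' i"
  unfolding mixture_def by (intro sum.cong) auto

lemma plausible_cong_book:
  assumes "\<And>k i. k \<in> D \<Longrightarrow> i < n \<Longrightarrow> c (k, w k, i) = c' (k, w k, i)" and "\<And>i. i < n \<Longrightarrow> y i = y' i"
  shows "plausible g D E n \<delta> c w y = plausible g D E n \<delta> c' w y'"
proof -
  have "mixture g D w c i = mixture g D w c' i" "mixture g (D - T) w c i = mixture g (D - T) w c' i" if "i < n" for T i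
    using that assms(1) by (auto intro!: mixture_cong_book)
  then show ?thesis unfolding plausible_def using assms(2) by simp
qed

lemma pred_plausible_received:
  assumes "finite D"
  shows "Measurable.pred (PiM {..<n} (\<lambda>_. borel)) (\<lambda>y. plausible g D E n \<delta> c w y)"
proof -
  have fin: "finite (Pow D)" using assms by simp
  have 1: "Measurable.pred (PiM {..<n} (\<lambda>_. borel :: real measure)) (\<lambda>y. (\<Sum>i<n. (y i - mixture g D w c i)\<^sup>2 / mixture_power g E i) \<le> real n * (1 + \<delta>))"
    by measurable
  have 2: "Measurable.pred (PiM {..<n} (\<lambda>_. borel :: real measure)) (\<lambda>y. \<forall>T\<in>Pow D. real n * (1 - \<delta>) \<le> (\<Sum>i<n. (y i - mixture g (D - T) w c i)\<^sup>2 / mixture_power g (E \<union> T) i))"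
    by (rule pred_intros_finite(3)[OF fin]) measurable
  show ?thesis unfolding plausible_def using 1 2 by measurable
qed

text \<open>Separates the codebook from the noise by Fubini. As layer 3 has a single message, its
  entries correspond one-to-one to the time slots and can be reindexed as a noise block.\<close>

lemma nn_integral_book:
  fixes f :: "(nat \<times> nat \<times> nat \<Rightarrow> real) \<Rightarrow> ennreal"
  assumes M3: "M 3 = 1" and K: "finite K" "3 \<notin> K"
    and f: "f \<in> borel_measurable (PiM (book_index (insert 3 K) M n) (\<lambda>_. gauss))"
  shows "(\<integral>\<^sup>+\<omega>. f \<omega> \<partial>PiM (book_index (insert 3 K) M n) (\<lambda>_. gauss))
    = (\<integral>\<^sup>+c. \<integral>\<^sup>+z. f (merge (book_index K M n) (book_index {3} M n) (c, \<lambda>j\<in>book_index {3} M n. z (snd (snd j))))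
         \<partial>noise_measure n \<partial>PiM (book_index K M n) (\<lambda>_. gauss))"
proof -
  interpret product_sigma_finite "\<lambda>_::nat \<times> nat \<times> nat. gauss" by (rule product_sigma_finite_gauss)
  have eq: "book_index (insert 3 K) M n = book_index K M n \<union> book_index {3} M n" by (auto simp: book_index_def)
  have disj: "book_index K M n \<inter> book_index {3} M n = {}" using K by (auto simp: book_index_def)
  have d: "distr (noise_measure n) (PiM (book_index {3} M n) (\<lambda>_. gauss)) (\<lambda>z. \<lambda>j\<in>book_index {3} M n. z (snd (snd j)))
     = PiM (book_index {3} M n) (\<lambda>_. gauss)"
    unfolding noise_measure_eq
    by (rule distr_PiM_reindex[where f = "\<lambda>j. snd (snd j)" and M = "\<lambda>_. gauss"])
       (auto simp: prob_space_gauss M3 inj_on_def)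
  have m: "(\<lambda>z. \<lambda>j\<in>book_index {3} M n. z (snd (snd j))) \<in> measurable (noise_measure n) (PiM (book_index {3} M n) (\<lambda>_. gauss))"
    unfolding noise_measure_eq by (intro measurable_restrict) (auto intro!: measurable_component_singleton)
  have fm: "(\<lambda>x. f (merge (book_index K M n) (book_index {3} M n) (c, x))) \<in> borel_measurable (PiM (book_index {3} M n) (\<lambda>_. gauss))"
    if "c \<in> space (PiM (book_index K M n) (\<lambda>_. gauss))" for c
  proof -
    have "(\<lambda>x. merge (book_index K M n) (book_index {3} M n) (c, x)) \<in> measurable (PiM (book_index {3} M n) (\<lambda>_. gauss)) (PiM (book_index (insert 3 K) M n) (\<lambda>_. gauss))"
      unfolding eq using that by measurable
    then show ?thesis using f by (rule measurable_compose)
  qed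
  have "(\<integral>\<^sup>+\<omega>. f \<omega> \<partial>PiM (book_index (insert 3 K) M n) (\<lambda>_. gauss))
    = (\<integral>\<^sup>+c. \<integral>\<^sup>+x. f (merge (book_index K M n) (book_index {3} M n) (c, x)) \<partial>PiM (book_index {3} M n) (\<lambda>_. gauss) \<partial>PiM (book_index K M n) (\<lambda>_. gauss))"
    unfolding eq using f disj K by (intro product_nn_integral_fold finite_book_index) (auto simp: eq)
  also have "\<dots> = (\<integral>\<^sup>+c. \<integral>\<^sup>+z. f (merge (book_index K M n) (book_index {3} M n) (c, \<lambda>j\<in>book_index {3} M n. z (snd (snd j))))
         \<partial>noise_measure n \<partial>PiM (book_index K M n) (\<lambda>_. gauss))"
  proof (rule nn_integral_cong)
    fix c assume "c \<in> space (PiM (book_index K M n) (\<lambda>_. gauss))"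
    from nn_integral_distr[OF m, of "\<lambda>x. f (merge (book_index K M n) (book_index {3} M n) (c, x))"] fm[OF this]
    show "(\<integral>\<^sup>+x. f (merge (book_index K M n) (book_index {3} M n) (c, x)) \<partial>PiM (book_index {3} M n) (\<lambda>_. gauss))
      = (\<integral>\<^sup>+z. f (merge (book_index K M n) (book_index {3} M n) (c, \<lambda>j\<in>book_index {3} M n. z (snd (snd j)))) \<partial>noise_measure n)"
      unfolding d by simp
  qed
  finally show ?thesis .
qed

text \<open>The factor 2 leaves room for a contradiction from a non-strict comparison of
  integrals.\<close>

lemma (in prob_space) exists_le_nn_integral:
  assumes "(\<integral>\<^sup>+x. f x \<partial>M) \<le> ennreal X" and "X > 0"
  shows "\<exists>x\<in>space M. f x \<le> ennreal (2 * X)"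
proof (rule ccontr)
  assume "\<not> ?thesis"
  then have "(\<integral>\<^sup>+x. ennreal (2 * X) \<partial>M) \<le> (\<integral>\<^sup>+x. f x \<partial>M)"
    by (intro nn_integral_mono) (auto simp: not_le less_imp_le)
  then have "ennreal (2 * X) \<le> ennreal X"
    using assms(1) by (simp add: emeasure_space_1)
  then show False using assms(2) by simp
qed

text \<open>
  Codewords violating the power constraint are replaced by zero. The violation is counted as an error, which
  is harmless because the error criterion is an average over the messages.
\<close>

lemma block_code_exists:
  fixes s :: "nat \<Rightarrow> nat \<Rightarrow> real" and M :: "nat \<Rightarrow> nat" and a b P1 P2 \<delta> e :: real and n M1 M2 :: nat
  defines "K \<equiv> {0, 1, 2, 3}"
  defines "\<Omega> \<equiv> PiM (book_index K M n) (\<lambda>_. gauss)"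
  defines "g1 \<equiv> (\<lambda>k i. (if k = 2 then b else 1) * s k i)"
    and "g2 \<equiv> (\<lambda>k i. (if k < 2 then a else 1) * s k i)"
  assumes M: "0 < M1" "M1 \<le> M 0 * M 1" "0 < M2" "M 2 = M2" "M 3 = 1"
    and s3: "\<And>i. s 3 i = 1" and P: "0 \<le> P1" "0 \<le> P2" and e: "0 < e"
    and err1: "\<And>w. (\<And>k. k \<in> K \<Longrightarrow> w k < M k) \<Longrightarrow>
        emeasure \<Omega> {\<omega> \<in> space \<Omega>. decoding_error g1 {0, 1, 2} {3} M n \<delta> w \<omega>} \<le> ennreal e"
    and err2: "\<And>w. (\<And>k. k \<in> K \<Longrightarrow> w k < M k) \<Longrightarrow>
        emeasure \<Omega> {\<omega> \<in> space \<Omega>. decoding_error g2 {1, 2} {0, 3} M n \<delta> w \<omega>} \<le> ennreal e"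
    and pow1: "\<And>w. (\<And>k. k \<in> K \<Longrightarrow> w k < M k) \<Longrightarrow>
        emeasure \<Omega> {\<omega> \<in> space \<Omega>. real n * P1 \<le> (\<Sum>i<n. (mixture s {0, 1} w \<omega> i)\<^sup>2)} \<le> ennreal e"
    and pow2: "\<And>w. (\<And>k. k \<in> K \<Longrightarrow> w k < M k) \<Longrightarrow>
        emeasure \<Omega> {\<omega> \<in> space \<Omega>. real n * P2 \<le> (\<Sum>i<n. (mixture s {2} w \<omega> i)\<^sup>2)} \<le> ennreal e"
  shows "\<exists>C. valid_ic_code P1 P2 n M1 M2 C \<and> error_prob1 b n M1 M2 C \<le> 8 * e \<and> error_prob2 a n M1 M2 C \<le> 8 * e"
proof -
  have K_eq: "K = insert 3 {0, 1, 2}" by (auto simp: K_def)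
  \<comment> \<open>Transmitter 1 writes its message in base \<open>M 0\<close>: the remainder goes
    to the private layer and the quotient to the common one. Distinct messages thus differ in some
    layer. Layer 3, the noise, always carries message 0.\<close>
  define tup where "tup m v = (\<lambda>k::nat. if k = 0 then m mod M 0 else if k = 1 then m div M 0 else if k = 2 then v else 0)" for m v
  have tup: "tup m v k < M k" if "m < M1" "v < M2" "k \<in> K" for m v k
  proof -
    have "M 0 > 0" using M by (cases "M 0") auto
    moreover have "m div M 0 < M 1"
      using that(1) M(2) by (intro less_mult_imp_div_less) (simp add: mult.commute)
    ultimately show ?thesis using that M by (auto simp: tup_def K_def)
  qed
  \<comment> \<open>One bad event covers both receivers and both power constraints, so that a single
    codebook can be good for everything at once. Both receivers are analysed with the same noise
    sample; each error probability depends only on the marginal law of its own noise.\<close>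
  define B where "B m v = {\<omega> \<in> space \<Omega>. decoding_error g1 {0, 1, 2} {3} M n \<delta> (tup m v) \<omega>}
     \<union> {\<omega> \<in> space \<Omega>. decoding_error g2 {1, 2} {0, 3} M n \<delta> (tup m v) \<omega>}
     \<union> {\<omega> \<in> space \<Omega>. real n * P1 \<le> (\<Sum>i<n. (mixture s {0, 1} (tup m v) \<omega> i)\<^sup>2)}
     \<union> {\<omega> \<in> space \<Omega>. real n * P2 \<le> (\<Sum>i<n. (mixture s {2} (tup m v) \<omega> i)\<^sup>2)}" for m v
  have B: "B m v \<in> sets \<Omega>" "emeasure \<Omega> (B m v) \<le> ennreal (4 * e)" if mv: "m < M1" "v < M2" for m v
  proof -
    have t: "tup m v k < M k" if "k \<in> K" for k using tup[OF mv that] .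
    have s1: "{\<omega> \<in> space \<Omega>. decoding_error g1 {0, 1, 2} {3} M n \<delta> (tup m v) \<omega>} \<in> sets \<Omega>"
      unfolding \<Omega>_def using t by (intro sets_decoding_error) (auto simp: K_def)
    have s2: "{\<omega> \<in> space \<Omega>. decoding_error g2 {1, 2} {0, 3} M n \<delta> (tup m v) \<omega>} \<in> sets \<Omega>"
      unfolding \<Omega>_def using t by (intro sets_decoding_error) (auto simp: K_def)
    have [measurable]: "(\<lambda>\<omega>. mixture s {0, 1} (tup m v) \<omega> i) \<in> borel_measurable \<Omega>"
      "(\<lambda>\<omega>. mixture s {2} (tup m v) \<omega> i) \<in> borel_measurable \<Omega>" if "i \<in> {..<n}" for i
      unfolding \<Omega>_def using that t by (auto intro!: measurable_mixture simp: K_def)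
    have s3: "{\<omega> \<in> space \<Omega>. real n * P1 \<le> (\<Sum>i<n. (mixture s {0, 1} (tup m v) \<omega> i)\<^sup>2)} \<in> sets \<Omega>"
      by measurable
    have s4: "{\<omega> \<in> space \<Omega>. real n * P2 \<le> (\<Sum>i<n. (mixture s {2} (tup m v) \<omega> i)\<^sup>2)} \<in> sets \<Omega>"
      by measurable
    show "B m v \<in> sets \<Omega>" unfolding B_def using s1 s2 s3 s4 by (intro sets.Un)
    have "emeasure \<Omega> (B m v) \<le> ennreal e + ennreal e + ennreal e + ennreal e"
      unfolding B_def
      by (intro order_trans[OF emeasure_subadditive add_mono] sets.Un s1 s2 s3 s4 err1 err2 pow1 pow2 t order_refl)
    also have "\<dots> = ennreal (4 * e)" using e by (simp add: ennreal_plus[symmetric] del: ennreal_plus)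
    finally show "emeasure \<Omega> (B m v) \<le> ennreal (4 * e)" .
  qed
  define mrg where "mrg c z = merge (book_index {0, 1, 2} M n) (book_index {3} M n) (c, \<lambda>j\<in>book_index {3} M n. z (snd (snd j)))"
    for c :: "nat \<times> nat \<times> nat \<Rightarrow> real" and z :: "nat \<Rightarrow> real"
  \<comment> \<open>Four failure events of measure at most \<open>e\<close> per message pair, summed
    over all pairs. The selected codebook exceeds this mean by at most a factor 2, whence
    \<open>8 * e\<close>.\<close>
  define X where "X = real M1 * real M2 * (4 * e)"
  have X: "X > 0" using M e by (simp add: X_def)
  have fm: "(\<lambda>\<omega>. \<Sum>m<M1. \<Sum>v<M2. indicator (B m v) \<omega> :: ennreal) \<in> borel_measurable \<Omega>"
    using B(1) by (intro borel_measurable_sum borel_measurable_indicator) auto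
  have "(\<integral>\<^sup>+\<omega>. (\<Sum>m<M1. \<Sum>v<M2. indicator (B m v) \<omega>) \<partial>\<Omega>) = (\<Sum>m<M1. \<Sum>v<M2. emeasure \<Omega> (B m v))"
  proof -
    have "(\<integral>\<^sup>+\<omega>. (\<Sum>m<M1. \<Sum>v<M2. indicator (B m v) \<omega>) \<partial>\<Omega>) = (\<Sum>m<M1. \<integral>\<^sup>+\<omega>. (\<Sum>v<M2. indicator (B m v) \<omega>) \<partial>\<Omega>)"
      using B(1) by (intro nn_integral_sum borel_measurable_sum borel_measurable_indicator) auto
    also have "\<dots> = (\<Sum>m<M1. \<Sum>v<M2. \<integral>\<^sup>+\<omega>. indicator (B m v) \<omega> \<partial>\<Omega>)"
      using B(1) by (intro sum.cong refl nn_integral_sum borel_measurable_indicator) auto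
    finally show ?thesis using B(1) by simp
  qed
  also have "\<dots> \<le> (\<Sum>m<M1. \<Sum>v<M2. ennreal (4 * e))"
    using B(2) by (intro sum_mono) auto
  also have "\<dots> = ennreal X"
    using e by (simp add: X_def ennreal_mult ennreal_of_nat_eq_real_of_nat mult.assoc)
  finally have "(\<integral>\<^sup>+c. \<integral>\<^sup>+z. (\<Sum>m<M1. \<Sum>v<M2. indicator (B m v) (mrg c z)) \<partial>noise_measure n \<partial>PiM (book_index {0, 1, 2} M n) (\<lambda>_. gauss)) \<le> ennreal X"
    unfolding mrg_def \<Omega>_def K_eq
    using nn_integral_book[of M "{0, 1, 2}" "\<lambda>\<omega>. \<Sum>m<M1. \<Sum>v<M2. indicator (B m v) \<omega>" n] fm M(5)
    by (simp add: \<Omega>_def K_eq)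
  then obtain c where c: "c \<in> space (PiM (book_index {0, 1, 2} M n) (\<lambda>_. gauss))"
    and cX: "(\<integral>\<^sup>+z. (\<Sum>m<M1. \<Sum>v<M2. indicator (B m v) (mrg c z)) \<partial>noise_measure n) \<le> ennreal (2 * X)"
    using prob_space.exists_le_nn_integral[OF prob_space_PiM[OF prob_space_gauss] _ X] by blast
  have mrg_m: "mrg c \<in> measurable (noise_measure n) \<Omega>"
  proof -
    have m1: "(\<lambda>z. \<lambda>j\<in>book_index {3} M n. z (snd (snd j))) \<in> measurable (noise_measure n) (PiM (book_index {3} M n) (\<lambda>_. gauss))"
      unfolding noise_measure_eq by (intro measurable_restrict) (auto intro!: measurable_component_singleton)
    have eq: "book_index K M n = book_index {0, 1, 2} M n \<union> book_index {3} M n" by (auto simp: book_index_def K_eq)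
    have m2: "(\<lambda>x. merge (book_index {0, 1, 2} M n) (book_index {3} M n) (c, x)) \<in> measurable (PiM (book_index {3} M n) (\<lambda>_. gauss)) \<Omega>"
      unfolding \<Omega>_def eq using c by measurable
    show ?thesis unfolding mrg_def using measurable_compose[OF m1 m2] .
  qed
  have mrg_c: "mrg c z (k, m, i) = c (k, m, i)" if "k \<in> {0, 1, 2}" "m < M k" "i < n" for z k m i
    using that unfolding mrg_def by (auto simp: merge_def)
  have mrg_z: "mrg c z (3, 0, i) = z i" if "i < n" for z i
    using that M(5) unfolding mrg_def by (auto simp: merge_def)
  have mrg_mixture: "mixture g T (tup m v) (mrg c z) i = mixture g T (tup m v) c i"
    if "m < M1" "v < M2" "T \<subseteq> {0, 1, 2}" "i < n" for g T m v z i
    using that tup[OF that(1,2)] by (intro mixture_cong_book mrg_c) (auto simp: K_def)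
  have mrg_plausible: "plausible g D E n \<delta> (mrg c z) (tup m v) y = plausible g D E n \<delta> c (tup m v) y'"
    if "m < M1" "v < M2" "D \<subseteq> {0, 1, 2}" "\<And>i. i < n \<Longrightarrow> y i = y' i" for g D E m v y y' z
    using that tup[OF that(1,2)] by (intro plausible_cong_book mrg_c) (auto simp: K_def)
  \<comment> \<open>The message 0 of the other transmitter is a dummy: layers 0 and 1 of
    \<open>tup m v\<close> depend on \<open>m\<close> only, layer 2 on \<open>v\<close> only. So
    neither encoder uses the other's message.\<close>
  define ok1 where "ok1 m \<longleftrightarrow> (\<Sum>i<n. (mixture s {0, 1} (tup m 0) c i)\<^sup>2) < real n * P1" for m
  define ok2 where "ok2 v \<longleftrightarrow> (\<Sum>i<n. (mixture s {2} (tup 0 v) c i)\<^sup>2) < real n * P2" for v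
  \<comment> \<open>Both decoders search jointly and output only the wanted message.
    \<open>LEAST\<close> makes them total: without a plausible candidate the output is an arbitrary
    fixed value. For receiver 2 the quantified \<open>m\<close> matters only through its
    common-layer part.\<close>
  define C where "C = \<lparr> enc1 = (\<lambda>m i. if ok1 m then mixture s {0, 1} (tup m 0) c i else 0),
      enc2 = (\<lambda>v i. if ok2 v then mixture s {2} (tup 0 v) c i else 0),
      dec1 = (\<lambda>y. LEAST m. m < M1 \<and> (\<exists>v<M2. plausible g1 {0, 1, 2} {3} n \<delta> c (tup m v) y)),
      dec2 = (\<lambda>y. LEAST v. v < M2 \<and> (\<exists>m<M1. plausible g2 {1, 2} {0, 3} n \<delta> c (tup m v) y)) \<rparr>"
  have valid: "valid_ic_code P1 P2 n M1 M2 C"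
    unfolding valid_ic_code_def
  proof (intro conjI allI impI)
    fix m
    show "(\<Sum>i<n. (enc1 C m i)\<^sup>2) / real n \<le> P1"
    \<comment> \<open>At \<open>n = 0\<close> the quotient is 0 by the convention on division by
      zero; if \<open>ok1 m\<close> fails the transmitted block is zero.\<close>
    proof (cases "n = 0 \<or> \<not> ok1 m")
      case False
      then show ?thesis unfolding C_def ok1_def by (simp add: divide_le_eq mult.commute)
    qed (use P in \<open>auto simp: C_def\<close>)
  next
    fix v
    show "(\<Sum>i<n. (enc2 C v i)\<^sup>2) / real n \<le> P2"
    proof (cases "n = 0 \<or> \<not> ok2 v")
      case False
      then show ?thesis unfolding C_def ok2_def by (simp add: divide_le_eq mult.commute)
    qed (use P in \<open>auto simp: C_def\<close>)
  next
    have [measurable]: "Measurable.pred (PiM {..<n} (\<lambda>_. borel)) (\<lambda>y. plausible g1 {0, 1, 2} {3} n \<delta> c (tup m v) y)" for m v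
      by (rule pred_plausible_received) simp
    show "dec1 C \<in> PiM {..<n} (\<lambda>_. borel) \<rightarrow>\<^sub>M count_space UNIV"
      unfolding C_def ic_code.simps by measurable
  next
    have [measurable]: "Measurable.pred (PiM {..<n} (\<lambda>_. borel)) (\<lambda>y. plausible g2 {1, 2} {0, 3} n \<delta> c (tup m v) y)" for m v
      by (rule pred_plausible_received) simp
    show "dec2 C \<in> PiM {..<n} (\<lambda>_. borel) \<rightarrow>\<^sub>M count_space UNIV"
      unfolding C_def ic_code.simps by measurable
  qed
  have correct: "dec1 C (output1 b n C m v z) = m \<and> dec2 C (output2 a n C m v z) = v"
    if mv: "m < M1" "v < M2" and z: "z \<in> space (noise_measure n)" and nB: "mrg c z \<notin> B m v" for m v z
  proof -
    let ?\<omega> = "mrg c z"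
    have sp: "?\<omega> \<in> space \<Omega>" using measurable_space[OF mrg_m z] .
    have l1: "mixture s {0, 1} (tup m 0) c i = mixture s {0, 1} (tup m v) c i"
      and l2: "mixture s {2} (tup 0 v) c i = mixture s {2} (tup m v) c i" for i
      by (auto intro!: mixture_cong simp: tup_def)
    have ok: "ok1 m" "ok2 v"
      using nB sp mv unfolding B_def ok1_def ok2_def l1 l2 by (auto simp: mrg_mixture not_le)
    have y1: "output1 b n C m v z i = mixture g1 ({0, 1, 2} \<union> {3}) (tup m v) ?\<omega> i" if "i < n" for i
    proof -
      have "mixture g1 ({0, 1, 2} \<union> {3}) (tup m v) ?\<omega> i = mixture g1 {0, 1, 2} (tup m v) c i + mixture g1 {3} (tup m v) ?\<omega> i"
        using that mv by (subst mixture_Un) (auto simp: mrg_mixture)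
      also have "mixture g1 {3} (tup m v) ?\<omega> i = z i"
        using that mrg_z[OF that, of z] by (simp add: mixture_def g1_def s3 tup_def)
      finally show ?thesis
        using ok that unfolding output1_def C_def by (simp add: mixture_def g1_def tup_def algebra_simps)
    qed
    have y2: "output2 a n C m v z i = mixture g2 ({1, 2} \<union> {0, 3}) (tup m v) ?\<omega> i" if "i < n" for i
    proof -
      have "mixture g2 ({1, 2} \<union> {0, 3}) (tup m v) ?\<omega> i = mixture g2 ({0, 1, 2} \<union> {3}) (tup m v) ?\<omega> i"
        by (rule arg_cong[where f = "\<lambda>T. mixture g2 T (tup m v) ?\<omega> i"]) auto
      also have "\<dots> = mixture g2 {0, 1, 2} (tup m v) c i + mixture g2 {3} (tup m v) ?\<omega> i"
        using that mv by (subst mixture_Un) (auto simp: mrg_mixture)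
      also have "mixture g2 {3} (tup m v) ?\<omega> i = z i"
        using that mrg_z[OF that, of z] by (simp add: mixture_def g2_def s3 tup_def)
      finally show ?thesis
        using ok that unfolding output2_def C_def by (simp add: mixture_def g2_def tup_def algebra_simps)
    qed
    have nd1: "\<not> decoding_error g1 {0, 1, 2} {3} M n \<delta> (tup m v) ?\<omega>"
      and nd2: "\<not> decoding_error g2 {1, 2} {0, 3} M n \<delta> (tup m v) ?\<omega>"
      using nB sp unfolding B_def by auto
    have t1: "plausible g1 {0, 1, 2} {3} n \<delta> c (tup m v) (output1 b n C m v z)"
      using nd1 y1 mv unfolding decoding_error_def by (subst mrg_plausible[symmetric]) auto
    have t2: "plausible g2 {1, 2} {0, 3} n \<delta> c (tup m v) (output2 a n C m v z)"
      using nd2 y2 mv unfolding decoding_error_def by (subst mrg_plausible[symmetric]) auto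
    have u1: "m' = m" if g: "m' < M1" "v' < M2" "plausible g1 {0, 1, 2} {3} n \<delta> c (tup m' v') (output1 b n C m v z)" for m' v'
    proof (rule ccontr)
      assume "m' \<noteq> m"
      then have "\<exists>k\<in>{0, 1, 2}. tup m' v' k \<noteq> tup m v k"
      proof -
        have "m' mod M 0 \<noteq> m mod M 0 \<or> m' div M 0 \<noteq> m div M 0"
          using \<open>m' \<noteq> m\<close> by (metis div_mult_mod_eq)
        then show ?thesis by (auto simp: tup_def)
      qed
      \<comment> \<open>The tuples in \<open>decoding_error\<close> are extensional functions, so
        the candidate is restricted to the decoded layers; \<open>plausible\<close> inspects no
        others.\<close>
      then have "\<exists>k\<in>{0, 1, 2}. restrict (tup m' v') {0, 1, 2} k \<noteq> tup m v k" by auto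
      moreover have "plausible g1 {0, 1, 2} {3} n \<delta> ?\<omega> (tup m' v') (mixture g1 ({0, 1, 2} \<union> {3}) (tup m v) ?\<omega>)"
        using g y1 by (subst mrg_plausible) auto
      then have "plausible g1 {0, 1, 2} {3} n \<delta> ?\<omega> (restrict (tup m' v') {0, 1, 2}) (mixture g1 ({0, 1, 2} \<union> {3}) (tup m v) ?\<omega>)"
        by (subst plausible_cong[of _ _ "tup m' v'"]) auto
      moreover have "restrict (tup m' v') {0, 1, 2} \<in> PiE {0, 1, 2} (\<lambda>k. {..<M k})"
        using tup[OF g(1,2)] by (auto simp: K_def)
      ultimately show False
        using nd1 unfolding decoding_error_def by blast
    qed
    have u2: "v' = v" if g: "m' < M1" "v' < M2" "plausible g2 {1, 2} {0, 3} n \<delta> c (tup m' v') (output2 a n C m v z)" for m' v'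
    proof (rule ccontr)
      assume "v' \<noteq> v"
      then have "\<exists>k\<in>{1, 2}. tup m' v' k \<noteq> tup m v k"
        unfolding tup_def by auto
      then have "\<exists>k\<in>{1, 2}. restrict (tup m' v') {1, 2} k \<noteq> tup m v k" by auto
      moreover have "plausible g2 {1, 2} {0, 3} n \<delta> ?\<omega> (tup m' v') (mixture g2 ({1, 2} \<union> {0, 3}) (tup m v) ?\<omega>)"
        using g y2 by (subst mrg_plausible) auto
      then have "plausible g2 {1, 2} {0, 3} n \<delta> ?\<omega> (restrict (tup m' v') {1, 2}) (mixture g2 ({1, 2} \<union> {0, 3}) (tup m v) ?\<omega>)"
        by (subst plausible_cong[of _ _ "tup m' v'"]) auto
      moreover have "restrict (tup m' v') {1, 2} \<in> PiE {1, 2} (\<lambda>k. {..<M k})"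
        using tup[OF g(1,2)] by (auto simp: K_def)
      ultimately show False
        using nd2 unfolding decoding_error_def by blast
    qed
    have "dec1 C (output1 b n C m v z) = (LEAST m'. m' < M1 \<and> (\<exists>v'<M2. plausible g1 {0, 1, 2} {3} n \<delta> c (tup m' v') (output1 b n C m v z)))"
      by (simp add: C_def)
    also have "\<dots> = m"
    proof (rule Least_equality)
      fix y assume "y < M1 \<and> (\<exists>v'<M2. plausible g1 {0, 1, 2} {3} n \<delta> c (tup y v') (output1 b n C m v z))"
      then show "m \<le> y" using u1 by auto
    qed (use t1 mv in blast)
    finally have d1: "dec1 C (output1 b n C m v z) = m" .
    have "dec2 C (output2 a n C m v z) = (LEAST v'. v' < M2 \<and> (\<exists>m'<M1. plausible g2 {1, 2} {0, 3} n \<delta> c (tup m' v') (output2 a n C m v z)))"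
      by (simp add: C_def)
    also have "\<dots> = v"
    proof (rule Least_equality)
      fix y assume "y < M2 \<and> (\<exists>m'<M1. plausible g2 {1, 2} {0, 3} n \<delta> c (tup m' y) (output2 a n C m v z))"
      then show "v \<le> y" using u2 by auto
    qed (use t2 mv in blast)
    finally show ?thesis using d1 by simp
  qed
  interpret N: prob_space "noise_measure n"
    unfolding noise_measure_eq by (rule prob_space_PiM) (rule prob_space_gauss)
  have bound: "(\<Sum>m<M1. \<Sum>v<M2. measure (noise_measure n) (A m v)) / (real M1 * real M2) \<le> 8 * e"
    if A: "\<And>m v z. m < M1 \<Longrightarrow> v < M2 \<Longrightarrow> z \<in> A m v \<Longrightarrow> z \<in> space (noise_measure n) \<and> mrg c z \<in> B m v"
    for A
  proof -
    have "ennreal (\<Sum>m<M1. \<Sum>v<M2. measure (noise_measure n) (A m v))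
      = (\<Sum>m<M1. \<Sum>v<M2. emeasure (noise_measure n) (A m v))"
      by (simp add: N.emeasure_eq_measure sum_ennreal sum_nonneg)
    also have "\<dots> \<le> (\<Sum>m<M1. \<Sum>v<M2. \<integral>\<^sup>+z. indicator (B m v) (mrg c z) \<partial>noise_measure n)"
    proof (intro sum_mono)
      fix m v assume mv: "m \<in> {..<M1}" "v \<in> {..<M2}"
      then have S: "mrg c -` B m v \<inter> space (noise_measure n) \<in> sets (noise_measure n)"
        using measurable_sets[OF mrg_m] B(1) by auto
      have "emeasure (noise_measure n) (A m v) \<le> emeasure (noise_measure n) (mrg c -` B m v \<inter> space (noise_measure n))"
        using A mv S by (intro emeasure_mono) auto
      also have "\<dots> = (\<integral>\<^sup>+z. indicator (mrg c -` B m v \<inter> space (noise_measure n)) z \<partial>noise_measure n)"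
        using S by simp
      also have "\<dots> = (\<integral>\<^sup>+z. indicator (B m v) (mrg c z) \<partial>noise_measure n)"
        by (intro nn_integral_cong) (auto simp: indicator_def)
      finally show "emeasure (noise_measure n) (A m v) \<le> (\<integral>\<^sup>+z. indicator (B m v) (mrg c z) \<partial>noise_measure n)" .
    qed
    also have "\<dots> = (\<integral>\<^sup>+z. (\<Sum>m<M1. \<Sum>v<M2. indicator (B m v) (mrg c z)) \<partial>noise_measure n)"
    proof -
      have [measurable]: "(\<lambda>z. indicator (B m v) (mrg c z) :: ennreal) \<in> borel_measurable (noise_measure n)"
        if "m \<in> {..<M1}" "v \<in> {..<M2}" for m v
        using that B(1) by (intro measurable_compose[OF mrg_m] borel_measurable_indicator) auto
      have "(\<integral>\<^sup>+z. (\<Sum>m<M1. \<Sum>v<M2. indicator (B m v) (mrg c z)) \<partial>noise_measure n)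
        = (\<Sum>m<M1. \<integral>\<^sup>+z. (\<Sum>v<M2. indicator (B m v) (mrg c z)) \<partial>noise_measure n)"
        by (intro nn_integral_sum) measurable
      also have "\<dots> = (\<Sum>m<M1. \<Sum>v<M2. \<integral>\<^sup>+z. indicator (B m v) (mrg c z) \<partial>noise_measure n)"
        by (intro sum.cong refl nn_integral_sum) measurable
      finally show ?thesis by simp
    qed
    also note cX
    finally have "(\<Sum>m<M1. \<Sum>v<M2. measure (noise_measure n) (A m v)) \<le> 2 * X"
      using X by (subst (asm) ennreal_le_iff) auto
    then show ?thesis using M by (simp add: X_def divide_le_eq algebra_simps)
  qed
  have "error_prob1 b n M1 M2 C \<le> 8 * e"
    unfolding error_prob1_def
  proof (rule bound)
    fix m v z assume "m < M1" "v < M2" "z \<in> {z \<in> space (noise_measure n). dec1 C (output1 b n C m v z) \<noteq> m}"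
    then show "z \<in> space (noise_measure n) \<and> mrg c z \<in> B m v" using correct[of m v z] by auto
  qed
  moreover have "error_prob2 a n M1 M2 C \<le> 8 * e"
    unfolding error_prob2_def
  proof (rule bound)
    fix m v z assume "m < M1" "v < M2" "z \<in> {z \<in> space (noise_measure n). dec2 C (output2 a n C m v z) \<noteq> v}"
    then show "z \<in> space (noise_measure n) \<and> mrg c z \<in> B m v" using correct[of m v z] by auto
  qed
  ultimately show ?thesis using valid by blast
qed

section \<open>Asymptotics of the two-band scheme\<close>

definition slots :: "real \<Rightarrow> nat \<Rightarrow> nat" where
  "slots lam n = nat \<lfloor>(1 - lam) * real n\<rfloor>"

text \<open>\<open>u\<close> and \<open>v\<close> are the powers of the layers in the two bands; the
  square root turns them into amplitudes. The gain \<open>\<gamma>\<close> of a layer is that of the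
  link to the receiver considered, or 1 at the transmitter.\<close>

definition two_band :: "(nat \<Rightarrow> real) \<Rightarrow> (nat \<Rightarrow> real) \<Rightarrow> (nat \<Rightarrow> real) \<Rightarrow> real \<Rightarrow> nat \<Rightarrow> nat \<Rightarrow> nat \<Rightarrow> real" where
  "two_band \<gamma> u v lam n k i = \<gamma> k * sqrt (if i < slots lam n then u k else v k)"

definition received :: "(nat \<Rightarrow> real) \<Rightarrow> (nat \<Rightarrow> real) \<Rightarrow> nat set \<Rightarrow> real" where
  "received \<gamma> u T = (\<Sum>k\<in>T. (\<gamma> k)\<^sup>2 * u k)"

text \<open>The capacity of a Gaussian link with signal-to-noise ratio \<open>x\<close> during a
  fraction \<open>1 - lam\<close> of the time and \<open>y\<close> during the rest.\<close>

definition band_rate :: "real \<Rightarrow> real \<Rightarrow> real \<Rightarrow> real \<Rightarrow> real" where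
  "band_rate \<beta> lam x y = (1 - lam) * (1 / 2 * log \<beta> (1 + x)) + lam * (1 / 2 * log \<beta> (1 + y))"

section \<open>Rounding the band boundary to whole slots\<close>

lemma slots_bounds:
  assumes "0 \<le> lam" "lam \<le> 1"
  shows "slots lam n \<le> n" "real (slots lam n) \<le> (1 - lam) * real n" "(1 - lam) * real n - 1 \<le> real (slots lam n)"
proof -
  have "(1 - lam) * real n \<ge> 0" using assms by simp
  then show 1: "real (slots lam n) \<le> (1 - lam) * real n" "(1 - lam) * real n - 1 \<le> real (slots lam n)"
    unfolding slots_def by linarith+
  have "(1 - lam) * real n \<le> 1 * real n" using assms by (intro mult_right_mono) auto
  with 1 show "slots lam n \<le> n" by linarith
qed

lemma prod_slots:
  fixes x y :: "'a :: comm_monoid_mult"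
  assumes "0 \<le> lam" "lam \<le> 1"
  shows "(\<Prod>i<n. if i < slots lam n then x else y) = x ^ slots lam n * y ^ (n - slots lam n)"
proof -
  have "{..<n} \<inter> {i. i < slots lam n} = {..<slots lam n}" "{..<n} \<inter> - {i. i < slots lam n} = {slots lam n..<n}"
    using slots_bounds(1)[OF assms, of n] by auto
  then show ?thesis by (simp add: prod.If_cases)
qed

lemma sum_slots:
  fixes x y :: real
  assumes "0 \<le> lam" "lam \<le> 1"
  shows "(\<Sum>i<n. if i < slots lam n then x else y) = real (slots lam n) * x + real (n - slots lam n) * y"
proof -
  have "{..<n} \<inter> {i. i < slots lam n} = {..<slots lam n}" "{..<n} \<inter> - {i. i < slots lam n} = {slots lam n..<n}"
    using slots_bounds(1)[OF assms, of n] by auto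
  then show ?thesis by (simp add: sum.If_cases)
qed

lemma mixture_power_two_band:
  assumes "\<And>k. k \<in> T \<Longrightarrow> 0 \<le> u k" "\<And>k. k \<in> T \<Longrightarrow> 0 \<le> v k"
  shows "mixture_power (two_band \<gamma> u v lam n) T i = (if i < slots lam n then received \<gamma> u T else received \<gamma> v T)"
  unfolding mixture_power_def two_band_def received_def using assms
  by (auto intro!: sum.cong simp: power_mult_distrib)

text \<open>
  Wrong messages number \<open>num_messages - 1\<close>, which vanishes at rate 0. Hence no rate constraint is needed
  for sets containing a layer of rate 0, and constraints with strict slack can be demanded of the others.
\<close>

lemma num_messages_minus_one:
  assumes "1 < \<beta>"
  shows "real (num_messages \<beta> n R - 1) \<le> \<beta> powr (real n * R)"
proof -
  have "0 < \<beta> powr (real n * R)" using assms by simp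
  then show ?thesis unfolding num_messages_def by linarith
qed

lemma num_messages_pos:
  assumes "1 < \<beta>"
  shows "0 < num_messages \<beta> n R"
proof -
  have "0 < \<beta> powr (real n * R)" using assms by simp
  then show ?thesis unfolding num_messages_def by linarith
qed

lemma num_messages_0 [simp]: "1 < \<beta> \<Longrightarrow> num_messages \<beta> n 0 = 1"
  by (simp add: num_messages_def)

text \<open>The product on the right is an integer above the power, so it absorbs the ceiling on the
  left. Splitting a rate between two layers therefore leaves enough codewords for all
  messages.\<close>

lemma num_messages_add:
  assumes "1 < \<beta>"
  shows "num_messages \<beta> n (R + R') \<le> num_messages \<beta> n R * num_messages \<beta> n R'"
proof -
  have pos: "0 < \<beta> powr (real n * R)" "0 < \<beta> powr (real n * R')" using assms by auto
  have "\<beta> powr (real n * (R + R')) = \<beta> powr (real n * R) * \<beta> powr (real n * R')"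
    by (simp add: distrib_left powr_add)
  also have "\<dots> \<le> real (num_messages \<beta> n R) * real (num_messages \<beta> n R')"
    using pos unfolding num_messages_def by (intro mult_mono) linarith+
  also have "\<dots> = real (num_messages \<beta> n R * num_messages \<beta> n R')" by simp
  finally have "\<lceil>\<beta> powr (real n * (R + R'))\<rceil> \<le> int (num_messages \<beta> n R * num_messages \<beta> n R')"
    by (simp add: ceiling_le_iff)
  then show ?thesis unfolding num_messages_def[of _ _ "R + R'"] by (simp add: nat_le_iff)
qed

section \<open>Vanishing of the error bounds\<close>

lemma tendsto_exp_linear:
  fixes c x :: real
  assumes "x > 0"
  shows "(\<lambda>n. c * exp (- (real n * x))) \<longlonglongrightarrow> 0"
proof -
  have "norm (exp (- x)) < 1" using assms by simp
  then have "(\<lambda>n. exp (- x) ^ n) \<longlonglongrightarrow> 0" by (rule LIMSEQ_power_zero)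
  then have "(\<lambda>n. c * exp (- x) ^ n) \<longlonglongrightarrow> c * 0" by (intro tendsto_mult tendsto_const)
  then show ?thesis by (simp add: exp_of_nat_mult[symmetric])
qed

text \<open>Rounding takes less than one slot from the first band; the factor
  \<open>sqrt (1 + x)\<close> pays for it.\<close>

lemma prod_two_band_le:
  assumes lam: "0 \<le> lam" "lam \<le> 1" and xy: "0 \<le> x" "0 \<le> y" and \<beta>: "1 < \<beta>"
  shows "(\<Prod>i<n. if i < slots lam n then 1 / sqrt (1 + x) else 1 / sqrt (1 + y))
    \<le> sqrt (1 + x) * exp (- (real n * (ln \<beta> * band_rate \<beta> lam x y)))"
proof -
  define X Y where "X = ln (1 + x) / 2" and "Y = ln (1 + y) / 2"
  have e: "1 / sqrt (1 + x) = exp (- X)" "1 / sqrt (1 + y) = exp (- Y)"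
    using xy by (simp_all add: X_def Y_def exp_minus ln_sqrt[symmetric] inverse_eq_divide)
  have s: "sqrt (1 + x) = exp X"
    using xy by (simp add: X_def ln_sqrt[symmetric])
  have l: "X \<ge> 0" "Y \<ge> 0" using xy by (auto simp: X_def Y_def)
  have "((1 - lam) * real n - 1) * X \<le> real (slots lam n) * X"
    using slots_bounds(3)[OF lam] l by (intro mult_right_mono) auto
  moreover have "lam * real n * Y \<le> real (n - slots lam n) * Y"
    using slots_bounds(1,2)[OF lam, of n] l by (intro mult_right_mono) (auto simp: of_nat_diff algebra_simps)
  ultimately have "- (real (slots lam n) * X) - real (n - slots lam n) * Y
     \<le> X - real n * ((1 - lam) * X + lam * Y)"
    by (simp add: algebra_simps)
  also have "(1 - lam) * X + lam * Y = ln \<beta> * band_rate \<beta> lam x y"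
    using \<beta> by (simp add: band_rate_def log_def X_def Y_def field_simps)
  finally have "exp (- (real (slots lam n) * X) - real (n - slots lam n) * Y)
     \<le> exp (X - real n * (ln \<beta> * band_rate \<beta> lam x y))"
    by simp
  moreover have "exp (- (real (slots lam n) * X) - real (n - slots lam n) * Y)
     = exp (- X) ^ slots lam n * exp (- Y) ^ (n - slots lam n)"
    by (simp add: exp_of_nat_mult[symmetric] mult_exp_exp)
  ultimately show ?thesis
    unfolding prod_slots[OF lam] e unfolding s by (simp add: mult_exp_exp)
qed

text \<open>Half of the slack \<open>\<eta> * ln \<beta>\<close> pays for the tolerance factor
  \<open>exp (real n * \<delta>)\<close>; the other half remains as the rate of decay.\<close>

lemma confusion_term_tendsto:
  assumes lam: "0 \<le> lam" "lam \<le> 1" and xy: "0 \<le> x" "0 \<le> y" and \<beta>: "1 < \<beta>" and \<eta>: "0 < \<eta>" "\<delta> \<le> \<eta> * ln \<beta> / 2"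
    and T: "finite T" and R: "\<And>k. k \<in> T \<Longrightarrow> 0 \<le> R k"
    and rate: "(\<And>k. k \<in> T \<Longrightarrow> 0 < R k) \<Longrightarrow> (\<Sum>k\<in>T. R k) + \<eta> \<le> band_rate \<beta> lam x y"
  shows "(\<lambda>n. (\<Prod>k\<in>T. real (num_messages \<beta> n (R k) - 1)) *
      (exp (real n * \<delta>) * (\<Prod>i<n. if i < slots lam n then 1 / sqrt (1 + x) else 1 / sqrt (1 + y)))) \<longlonglongrightarrow> 0"
    (is "?f \<longlonglongrightarrow> 0")
proof (cases "\<forall>k\<in>T. 0 < R k")
  case False
  then obtain k where "k \<in> T" "R k = 0" using R by (metis antisym_conv2)
  then have "real (num_messages \<beta> n (R k) - 1) = 0" for n
    using \<beta> by simp
  with \<open>k \<in> T\<close> have "(\<Prod>k\<in>T. real (num_messages \<beta> n (R k) - 1)) = 0" for n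
    using T by (intro prod_zero) blast+
  then show ?thesis by simp
next
  case True
  have lb: "ln \<beta> > 0" using \<beta> by simp
  have "?f n \<le> sqrt (1 + x) * exp (- (real n * (\<eta> * ln \<beta> / 2)))" for n
  proof -
    have "(\<Prod>k\<in>T. real (num_messages \<beta> n (R k) - 1)) \<le> (\<Prod>k\<in>T. \<beta> powr (real n * R k))"
      using \<beta> by (intro prod_mono conjI num_messages_minus_one) auto
    also have "\<dots> = exp (real n * (ln \<beta> * (\<Sum>k\<in>T. R k)))"
      using \<beta> T by (simp add: powr_def exp_sum[symmetric] sum_distrib_left mult_ac)
    finally have 1: "(\<Prod>k\<in>T. real (num_messages \<beta> n (R k) - 1)) \<le> exp (real n * (ln \<beta> * (\<Sum>k\<in>T. R k)))" .
    have "?f n \<le> exp (real n * (ln \<beta> * (\<Sum>k\<in>T. R k))) *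
       (exp (real n * \<delta>) * (sqrt (1 + x) * exp (- (real n * (ln \<beta> * band_rate \<beta> lam x y)))))"
      using prod_two_band_le[OF lam xy \<beta>] xy
      by (intro mult_mono 1 mult_nonneg_nonneg prod_nonneg) auto
    also have "\<dots> = sqrt (1 + x) * exp (real n * (ln \<beta> * (\<Sum>k\<in>T. R k) + \<delta> - ln \<beta> * band_rate \<beta> lam x y))"
      by (simp add: mult_exp_exp algebra_simps)
    also have "\<dots> \<le> sqrt (1 + x) * exp (real n * (- (\<eta> * ln \<beta> / 2)))"
    proof -
      have "ln \<beta> * ((\<Sum>k\<in>T. R k) + \<eta>) \<le> ln \<beta> * band_rate \<beta> lam x y"
        using rate True lb by (intro mult_left_mono) auto
      then have "ln \<beta> * (\<Sum>k\<in>T. R k) + \<delta> - ln \<beta> * band_rate \<beta> lam x y \<le> - (\<eta> * ln \<beta> / 2)"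
        using \<eta>(2) by (simp add: algebra_simps)
      then have "real n * (ln \<beta> * (\<Sum>k\<in>T. R k) + \<delta> - ln \<beta> * band_rate \<beta> lam x y) \<le> real n * (- (\<eta> * ln \<beta> / 2))"
        by (intro mult_left_mono) auto
      then show ?thesis using xy by (intro mult_left_mono) auto
    qed
    finally show ?thesis by simp
  qed
  moreover have "0 \<le> ?f n" for n
    using xy by (intro mult_nonneg_nonneg prod_nonneg) auto
  moreover have "(\<lambda>n. sqrt (1 + x) * exp (- (real n * (\<eta> * ln \<beta> / 2)))) \<longlonglongrightarrow> 0"
    using \<eta> lb by (intro tendsto_exp_linear) auto
  ultimately show ?thesis
    by (intro tendsto_sandwich[of "\<lambda>_. 0" ?f sequentially _ 0]) auto
qed

text \<open>The null sequence is obtained before the messages \<open>w\<close> are fixed, so it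
  bounds the error uniformly over all of them.\<close>

lemma decoding_error_tendsto:
  fixes K D E :: "nat set" and \<gamma> u v :: "nat \<Rightarrow> real" and M :: "nat \<Rightarrow> nat \<Rightarrow> nat"
  assumes DE: "finite D" "finite E" "D \<inter> E = {}" "D \<union> E \<subseteq> K" and K: "finite K"
    and uv: "\<And>k. 0 \<le> u k" "\<And>k. 0 \<le> v k"
    and pos: "0 < received \<gamma> u E" "0 < received \<gamma> v E"
    and lam: "0 \<le> lam" "lam \<le> 1" and \<beta>: "1 < \<beta>" and \<eta>: "0 < \<eta>" 
    and \<delta>: "0 < \<delta>" "\<delta> \<le> 1" "\<delta> \<le> \<eta> * ln \<beta> / 2"
    and M: "\<And>n k. k \<in> D \<Longrightarrow> M n k = num_messages \<beta> n (R k)"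
    and R: "\<And>k. k \<in> D \<Longrightarrow> 0 \<le> R k"
    and rate: "\<And>T. T \<subseteq> D \<Longrightarrow> T \<noteq> {} \<Longrightarrow> (\<And>k. k \<in> T \<Longrightarrow> 0 < R k) \<Longrightarrow>
       (\<Sum>k\<in>T. R k) + \<eta> \<le> band_rate \<beta> lam (received \<gamma> u T / received \<gamma> u E) (received \<gamma> v T / received \<gamma> v E)"
  obtains f where "f \<longlonglongrightarrow> 0"
    "\<And>n w. (\<And>k. k \<in> K \<Longrightarrow> w k < M n k) \<Longrightarrow>
      emeasure (PiM (book_index K (M n) n) (\<lambda>_. gauss)) {\<omega> \<in> space (PiM (book_index K (M n) n) (\<lambda>_. gauss)).
        decoding_error (two_band \<gamma> u v lam n) D E (M n) n \<delta> w \<omega>} \<le> ennreal (f n)"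
proof
  define q where "q T n = (\<Prod>k\<in>T. real (num_messages \<beta> n (R k) - 1)) *
      (exp (real n * \<delta>) * (\<Prod>i<n. if i < slots lam n then 1 / sqrt (1 + received \<gamma> u T / received \<gamma> u E)
         else 1 / sqrt (1 + received \<gamma> v T / received \<gamma> v E)))" for T n
  have q: "q T \<longlonglongrightarrow> 0" if T: "T \<in> Pow D - {{}}" for T
  proof -
    have "0 \<le> received \<gamma> u T" "0 \<le> received \<gamma> v T"
      unfolding received_def using uv by (auto intro!: sum_nonneg)
    then show ?thesis
      unfolding q_def using T DE(1) pos R rate[of T] \<eta> \<delta>
      by (intro confusion_term_tendsto[where \<eta> = \<eta>] lam \<beta>) (auto intro: finite_subset)
  qed
  show "(\<lambda>n. (1 + 2 ^ card D) * exp (- (real n * (\<delta>\<^sup>2 / 16))) + (\<Sum>T\<in>Pow D - {{}}. q T n)) \<longlonglongrightarrow> 0"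
    using \<delta>(1) by (intro tendsto_add_zero tendsto_exp_linear tendsto_null_sum q) auto
  fix n w assume w: "\<And>k. k \<in> K \<Longrightarrow> w k < M n k"
  have eE: "mixture_power (two_band \<gamma> u v lam n) E i > 0" for i
    using uv pos by (subst mixture_power_two_band) auto
  have qe: "(\<Prod>k\<in>T. real (M n k - 1)) * (exp (real n * \<delta>) *
      (\<Prod>i<n. 1 / sqrt (1 + mixture_power (two_band \<gamma> u v lam n) T i / mixture_power (two_band \<gamma> u v lam n) E i))) = q T n"
    if "T \<in> Pow D - {{}}" for T
    unfolding q_def using that uv M
    by (intro arg_cong2[where f = "(*)"] prod.cong refl) (auto simp: mixture_power_two_band subset_iff)
  show "emeasure (PiM (book_index K (M n) n) (\<lambda>_. gauss)) {\<omega> \<in> space (PiM (book_index K (M n) n) (\<lambda>_. gauss)).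
        decoding_error (two_band \<gamma> u v lam n) D E (M n) n \<delta> w \<omega>}
    \<le> ennreal ((1 + 2 ^ card D) * exp (- (real n * (\<delta>\<^sup>2 / 16))) + (\<Sum>T\<in>Pow D - {{}}. q T n))"
  proof -
    have "emeasure (PiM (book_index K (M n) n) (\<lambda>_. gauss)) {\<omega> \<in> space (PiM (book_index K (M n) n) (\<lambda>_. gauss)).
        decoding_error (two_band \<gamma> u v lam n) D E (M n) n \<delta> w \<omega>}
      \<le> ennreal ((1 + 2 ^ card D) * exp (- (real n * \<delta>\<^sup>2 / 16)) +
        (\<Sum>T\<in>Pow D - {{}}. (\<Prod>k\<in>T. real (M n k - 1)) * (exp (real n * \<delta>) *
          (\<Prod>i<n. 1 / sqrt (1 + mixture_power (two_band \<gamma> u v lam n) T i / mixture_power (two_band \<gamma> u v lam n) E i)))))"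
      using w DE(4) eE \<delta> by (intro emeasure_decoding_error DE K) auto
    also have "(\<Sum>T\<in>Pow D - {{}}. (\<Prod>k\<in>T. real (M n k - 1)) * (exp (real n * \<delta>) *
          (\<Prod>i<n. 1 / sqrt (1 + mixture_power (two_band \<gamma> u v lam n) T i / mixture_power (two_band \<gamma> u v lam n) E i))))
      = (\<Sum>T\<in>Pow D - {{}}. q T n)"
      by (rule sum.cong[OF refl qe])
    finally show ?thesis by simp
  qed
qed

lemma power_violation_tendsto:
  fixes K T :: "nat set" and \<gamma> u v :: "nat \<Rightarrow> real" and M :: "nat \<Rightarrow> nat \<Rightarrow> nat"
  assumes T: "T \<subseteq> K" and K: "finite K" and uv: "\<And>k. 0 \<le> u k" "\<And>k. 0 \<le> v k"
    and lam: "0 \<le> lam" "lam \<le> 1"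
    and P: "(1 - lam) * received \<gamma> u T + lam * received \<gamma> v T < P"
  obtains f where "f \<longlonglongrightarrow> 0"
    "\<And>n w. (\<And>k. k \<in> K \<Longrightarrow> w k < M n k) \<Longrightarrow>
      emeasure (PiM (book_index K (M n) n) (\<lambda>_. gauss)) {\<omega> \<in> space (PiM (book_index K (M n) n) (\<lambda>_. gauss)).
        real n * P \<le> (\<Sum>i<n. (mixture (two_band \<gamma> u v lam n) T w \<omega> i)\<^sup>2)} \<le> ennreal (f n)"
proof
  define U where "U = received \<gamma> u T"
  define V where "V = received \<gamma> v T"
  have UV: "0 \<le> U" "0 \<le> V"
    unfolding U_def V_def received_def using uv by (auto intro!: sum_nonneg)
  define P' where "P' = (1 - lam) * U + lam * V"
  have P': "0 \<le> P'" "P' < P" using P UV lam by (auto simp: P'_def U_def V_def)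
  define L where "L = U + V + 1"
  have L: "L > 0" using UV by (simp add: L_def)
  \<comment> \<open>The first entry keeps \<open>\<theta> * L \<le> 1 / 4\<close>, as the Chernoff
    bound requires. The second limits the second-order excess to half of the gap
    \<open>P - P'\<close>; the other half gives the decay. Writing \<open>P' + 1\<close> avoids a
    zero denominator.\<close>
  define \<theta> where "\<theta> = min (1 / (4 * L)) ((P - P') / (8 * L * (P' + 1)))"
  have \<theta>: "0 < \<theta>" using L P' by (auto simp: \<theta>_def)
  have \<theta>L: "\<theta> * L \<le> 1 / 4"
    using mult_right_mono[of \<theta> "1 / (4 * L)" L] L by (simp add: \<theta>_def)
  have "4 * \<theta> * L * (P' + 1) \<le> (P - P') / 2"
  proof -
    have "\<theta> * (8 * L * (P' + 1)) \<le> (P - P') / (8 * L * (P' + 1)) * (8 * L * (P' + 1))"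
      using L P' by (intro mult_right_mono) (auto simp: \<theta>_def)
    also have "\<dots> = P - P'" using L P' by simp
    finally show ?thesis by (simp add: algebra_simps)
  qed
  moreover have "4 * \<theta> * L * P' \<le> 4 * \<theta> * L * (P' + 1)"
    using \<theta> L by (intro mult_left_mono) auto
  ultimately have "P' + 4 * \<theta> * L * P' \<le> P' + (P - P') / 2"
    by (intro add_left_mono) (rule order_trans)
  also have "\<dots> = P - (P - P') / 2"
    by (simp add: field_simps)
  finally have gap: "(1 + 4 * \<theta> * L) * P' \<le> P - (P - P') / 2"
    by (simp add: distrib_right)
  show "(\<lambda>n. exp (\<theta> * (1 + 4 * \<theta> * L) * V) * exp (- (real n * (\<theta> * (P - P') / 2)))) \<longlonglongrightarrow> 0"
    using \<theta> P' by (intro tendsto_exp_linear) auto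
  fix n w assume w: "\<And>k. k \<in> K \<Longrightarrow> w k < M n k"
  have mixture_power: "mixture_power (two_band \<gamma> u v lam n) T i = (if i < slots lam n then U else V)" for i
    unfolding U_def V_def using uv by (intro mixture_power_two_band)
  have "(\<Sum>i<n. mixture_power (two_band \<gamma> u v lam n) T i) = real (slots lam n) * U + real (n - slots lam n) * V"
    unfolding mixture_power by (rule sum_slots[OF lam])
  \<comment> \<open>The slot lost by rounding down is at most one extra slot of the second band,
    hence the additive \<open>V\<close>.\<close>
  also have "\<dots> \<le> (1 - lam) * real n * U + (lam * real n + 1) * V"
    using slots_bounds[OF lam, of n] UV
    by (intro add_mono mult_right_mono) (auto simp: of_nat_diff algebra_simps)
  also have "\<dots> = real n * P' + V" by (simp add: P'_def algebra_simps)
  finally have S: "(\<Sum>i<n. mixture_power (two_band \<gamma> u v lam n) T i) \<le> real n * P' + V" .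
  have "emeasure (PiM (book_index K (M n) n) (\<lambda>_. gauss)) {\<omega> \<in> space (PiM (book_index K (M n) n) (\<lambda>_. gauss)).
        real n * P \<le> (\<Sum>i<n. (mixture (two_band \<gamma> u v lam n) T w \<omega> i)\<^sup>2)}
     \<le> ennreal (exp (- \<theta> * (real n * P) + \<theta> * (1 + 4 * \<theta> * L) * (real n * P' + V)))"
    using T K w UV L \<theta>L
    by (intro power_tail_mixture finite_book_index book_index_subset \<theta> S) (auto intro: finite_subset simp: mixture_power L_def)
  also have "\<dots> \<le> ennreal (exp (\<theta> * (1 + 4 * \<theta> * L) * V) * exp (- (real n * (\<theta> * (P - P') / 2))))"
  proof (rule ennreal_leI)
    have "\<theta> * real n * ((1 + 4 * \<theta> * L) * P') \<le> \<theta> * real n * (P - (P - P') / 2)"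
      using \<theta> by (intro mult_left_mono gap) auto
    then have "- \<theta> * (real n * P) + \<theta> * (1 + 4 * \<theta> * L) * (real n * P' + V)
      \<le> \<theta> * (1 + 4 * \<theta> * L) * V + - (real n * (\<theta> * (P - P') / 2))"
      by (simp add: algebra_simps)
    then show "exp (- \<theta> * (real n * P) + \<theta> * (1 + 4 * \<theta> * L) * (real n * P' + V))
      \<le> exp (\<theta> * (1 + 4 * \<theta> * L) * V) * exp (- (real n * (\<theta> * (P - P') / 2)))"
      by (simp only: mult_exp_exp exp_le_cancel_iff)
  qed
  finally show "emeasure (PiM (book_index K (M n) n) (\<lambda>_. gauss)) {\<omega> \<in> space (PiM (book_index K (M n) n) (\<lambda>_. gauss)).
        real n * P \<le> (\<Sum>i<n. (mixture (two_band \<gamma> u v lam n) T w \<omega> i)\<^sup>2)}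
     \<le> ennreal (exp (\<theta> * (1 + 4 * \<theta> * L) * V) * exp (- (real n * (\<theta> * (P - P') / 2))))" .
qed

section \<open>Achievability\<close>

lemma error_prob_nonneg: "0 \<le> error_prob1 b n M1 M2 C" "0 \<le> error_prob2 a n M1 M2 C"
  unfolding error_prob1_def error_prob2_def by (auto intro!: divide_nonneg_nonneg sum_nonneg)

lemma achievable_of_rates:
  fixes a b lam P1 P2 \<beta> \<eta> :: real and u v R :: "nat \<Rightarrow> real"
  defines "\<gamma>1 \<equiv> (\<lambda>k::nat. if k = 2 then b else 1)" and "\<gamma>2 \<equiv> (\<lambda>k::nat. if k < 2 then a else 1)"
  assumes uv: "\<And>k. 0 \<le> u k" "\<And>k. 0 \<le> v k" and uv3: "u 3 = 1" "v 3 = 1"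
    and lam: "0 \<le> lam" "lam \<le> 1" and \<beta>: "1 < \<beta>" and \<eta>: "0 < \<eta>"
    and P1: "(1 - lam) * (u 0 + u 1) + lam * (v 0 + v 1) < P1"
    and P2: "(1 - lam) * u 2 + lam * v 2 < P2"
    and R: "\<And>k. 0 \<le> R k"
    and rate1: "\<And>T. T \<subseteq> {0, 1, 2} \<Longrightarrow> T \<noteq> {} \<Longrightarrow> (\<And>k. k \<in> T \<Longrightarrow> 0 < R k) \<Longrightarrow>
       (\<Sum>k\<in>T. R k) + \<eta> \<le> band_rate \<beta> lam (received \<gamma>1 u T / received \<gamma>1 u {3}) (received \<gamma>1 v T / received \<gamma>1 v {3})"
    and rate2: "\<And>T. T \<subseteq> {1, 2} \<Longrightarrow> T \<noteq> {} \<Longrightarrow> (\<And>k. k \<in> T \<Longrightarrow> 0 < R k) \<Longrightarrow>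
       (\<Sum>k\<in>T. R k) + \<eta> \<le> band_rate \<beta> lam (received \<gamma>2 u T / received \<gamma>2 u {0, 3}) (received \<gamma>2 v T / received \<gamma>2 v {0, 3})"
  shows "achievable_rate_pair \<beta> a b P1 P2 (R 0 + R 1, R 2)"
proof -
  define K :: "nat set" where "K = {0, 1, 2, 3}"
  define M where "M n k = (if k < 3 then num_messages \<beta> n (R k) else 1)" for n k :: nat
  define \<delta> where "\<delta> = min 1 (\<eta> * ln \<beta> / 2)"
  define s where "s = two_band (\<lambda>_. 1) u v lam"
  have \<delta>: "0 < \<delta>" "\<delta> \<le> 1" "\<delta> \<le> \<eta> * ln \<beta> / 2" using \<eta> \<beta> by (auto simp: \<delta>_def)
  have g1: "two_band \<gamma>1 u v lam n = (\<lambda>k i. (if k = 2 then b else 1) * s n k i)"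
    and g2: "two_band \<gamma>2 u v lam n = (\<lambda>k i. (if k < 2 then a else 1) * s n k i)" for n
    unfolding two_band_def s_def \<gamma>1_def \<gamma>2_def by auto
  obtain f1 where f1: "f1 \<longlonglongrightarrow> 0"
    "\<And>n w. (\<And>k. k \<in> K \<Longrightarrow> w k < M n k) \<Longrightarrow>
      emeasure (PiM (book_index K (M n) n) (\<lambda>_. gauss)) {\<omega> \<in> space (PiM (book_index K (M n) n) (\<lambda>_. gauss)).
        decoding_error (two_band \<gamma>1 u v lam n) {0, 1, 2} {3} (M n) n \<delta> w \<omega>} \<le> ennreal (f1 n)"
    by (rule decoding_error_tendsto[of "{0, 1, 2}" "{3}" K u v \<gamma>1 lam \<beta> \<eta> \<delta> M R])
       (use uv uv3 lam \<beta> \<eta> \<delta> R rate1 in \<open>auto simp: K_def M_def received_def \<gamma>1_def\<close>)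
  obtain f2 where f2: "f2 \<longlonglongrightarrow> 0"
    "\<And>n w. (\<And>k. k \<in> K \<Longrightarrow> w k < M n k) \<Longrightarrow>
      emeasure (PiM (book_index K (M n) n) (\<lambda>_. gauss)) {\<omega> \<in> space (PiM (book_index K (M n) n) (\<lambda>_. gauss)).
        decoding_error (two_band \<gamma>2 u v lam n) {1, 2} {0, 3} (M n) n \<delta> w \<omega>} \<le> ennreal (f2 n)"
    by (rule decoding_error_tendsto[of "{1, 2}" "{0, 3}" K u v \<gamma>2 lam \<beta> \<eta> \<delta> M R])
       (use uv uv3 lam \<beta> \<eta> \<delta> R rate2 in \<open>auto simp: K_def M_def received_def \<gamma>2_def add_nonneg_pos\<close>)
  obtain f3 where f3: "f3 \<longlonglongrightarrow> 0"
    "\<And>n w. (\<And>k. k \<in> K \<Longrightarrow> w k < M n k) \<Longrightarrow>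
      emeasure (PiM (book_index K (M n) n) (\<lambda>_. gauss)) {\<omega> \<in> space (PiM (book_index K (M n) n) (\<lambda>_. gauss)).
        real n * P1 \<le> (\<Sum>i<n. (mixture (s n) {0, 1} w \<omega> i)\<^sup>2)} \<le> ennreal (f3 n)"
    unfolding s_def
    by (rule power_violation_tendsto[of "{0, 1}" K u v lam "\<lambda>_. 1" P1 M])
       (use uv lam P1 in \<open>auto simp: K_def received_def\<close>)
  obtain f4 where f4: "f4 \<longlonglongrightarrow> 0"
    "\<And>n w. (\<And>k. k \<in> K \<Longrightarrow> w k < M n k) \<Longrightarrow>
      emeasure (PiM (book_index K (M n) n) (\<lambda>_. gauss)) {\<omega> \<in> space (PiM (book_index K (M n) n) (\<lambda>_. gauss)).
        real n * P2 \<le> (\<Sum>i<n. (mixture (s n) {2} w \<omega> i)\<^sup>2)} \<le> ennreal (f4 n)"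
    unfolding s_def
    by (rule power_violation_tendsto[of "{2}" K u v lam "\<lambda>_. 1" P2 M])
       (use uv lam P2 in \<open>auto simp: K_def received_def\<close>)
  \<comment> \<open>The bounds merely tend to 0 and may fail to be positive. Absolute values and the
    extra summand give a common strictly positive null sequence.\<close>
  define e where "e n = \<bar>f1 n\<bar> + \<bar>f2 n\<bar> + \<bar>f3 n\<bar> + \<bar>f4 n\<bar> + inverse (real (Suc n))" for n
  have e0: "e \<longlonglongrightarrow> 0"
    unfolding e_def using f1(1) f2(1) f3(1) f4(1)
    by (intro tendsto_add_zero tendsto_rabs_zero LIMSEQ_inverse_real_of_nat)
  have e_pos: "0 < e n" for n unfolding e_def by (intro add_nonneg_pos) auto
  have fe: "f1 n \<le> e n" "f2 n \<le> e n" "f3 n \<le> e n" "f4 n \<le> e n" for n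
  proof -
    have "0 < inverse (real (Suc n))" by simp
    then show "f1 n \<le> e n" "f2 n \<le> e n" "f3 n \<le> e n" "f4 n \<le> e n" unfolding e_def by linarith+
  qed
  have "0 \<le> (1 - lam) * (u 0 + u 1) + lam * (v 0 + v 1)" "0 \<le> (1 - lam) * u 2 + lam * v 2"
    using uv lam by auto
  with P1 P2 have P0: "0 \<le> P1" "0 \<le> P2" by linarith+
  have "\<exists>C. valid_ic_code P1 P2 n (num_messages \<beta> n (R 0 + R 1)) (num_messages \<beta> n (R 2)) C
      \<and> error_prob1 b n (num_messages \<beta> n (R 0 + R 1)) (num_messages \<beta> n (R 2)) C \<le> 8 * e n
      \<and> error_prob2 a n (num_messages \<beta> n (R 0 + R 1)) (num_messages \<beta> n (R 2)) C \<le> 8 * e n" for n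
  proof (rule block_code_exists[where M = "M n" and s = "s n" and \<delta> = \<delta>])
    show "0 < num_messages \<beta> n (R 0 + R 1)" "0 < num_messages \<beta> n (R 2)"
      using num_messages_pos[OF \<beta>] by auto
    show "num_messages \<beta> n (R 0 + R 1) \<le> M n 0 * M n 1"
      using num_messages_add[OF \<beta>] by (simp add: M_def)
    show "M n 2 = num_messages \<beta> n (R 2)" "M n 3 = 1" by (simp_all add: M_def)
    show "s n 3 i = 1" for i by (simp add: s_def two_band_def uv3)
  qed (use P0 e_pos in \<open>auto simp only: K_def[symmetric] g1[symmetric] g2[symmetric]
      intro!: order_trans[OF f1(2)] order_trans[OF f2(2)] order_trans[OF f3(2)] order_trans[OF f4(2)] ennreal_leI fe\<close>)
  then obtain C where C: "\<And>n. valid_ic_code P1 P2 n (num_messages \<beta> n (R 0 + R 1)) (num_messages \<beta> n (R 2)) (C n)"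
    "\<And>n. error_prob1 b n (num_messages \<beta> n (R 0 + R 1)) (num_messages \<beta> n (R 2)) (C n) \<le> 8 * e n"
    "\<And>n. error_prob2 a n (num_messages \<beta> n (R 0 + R 1)) (num_messages \<beta> n (R 2)) (C n) \<le> 8 * e n"
    by metis
  have e8: "(\<lambda>n. 8 * e n) \<longlonglongrightarrow> 0" using tendsto_mult_right_zero[OF e0] .
  have "(\<lambda>n. error_prob1 b n (num_messages \<beta> n (R 0 + R 1)) (num_messages \<beta> n (R 2)) (C n)) \<longlonglongrightarrow> 0"
    by (rule tendsto_sandwich[OF _ _ tendsto_const e8]) (use C(2) error_prob_nonneg in auto)
  moreover have "(\<lambda>n. error_prob2 a n (num_messages \<beta> n (R 0 + R 1)) (num_messages \<beta> n (R 2)) (C n)) \<longlonglongrightarrow> 0"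
    by (rule tendsto_sandwich[OF _ _ tendsto_const e8]) (use C(3) error_prob_nonneg in auto)
  ultimately show ?thesis
    unfolding achievable_rate_pair_def using C(1) R by auto
qed

text \<open>Rates are logarithms, so a sum-rate constraint follows from an inequality between
  products of \<open>1 +\<close> signal-to-noise ratio, checked in each band separately.\<close>

lemma sum_band_rate_le:
  assumes "finite T" and \<beta>: "1 < \<beta>" and lam: "0 \<le> lam" "lam \<le> 1"
    and "\<And>k. k \<in> T \<Longrightarrow> 0 \<le> x k" "\<And>k. k \<in> T \<Longrightarrow> 0 \<le> y k"
    and le: "(\<Prod>k\<in>T. 1 + x k) \<le> 1 + x'" "(\<Prod>k\<in>T. 1 + y k) \<le> 1 + y'"
  shows "(\<Sum>k\<in>T. band_rate \<beta> lam (x k) (y k)) \<le> band_rate \<beta> lam x' y'"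
proof -
  have pos: "0 < (\<Prod>k\<in>T. 1 + x k)" "0 < (\<Prod>k\<in>T. 1 + y k)"
    using assms by (auto intro!: prod_pos add_pos_nonneg)
  have lg: "log \<beta> (\<Prod>k\<in>T. 1 + z k) = (\<Sum>k\<in>T. log \<beta> (1 + z k))" if z: "\<And>k. k \<in> T \<Longrightarrow> 0 \<le> z k" for z :: "'a \<Rightarrow> real"
  proof -
    have "0 < 1 + z k" if "k \<in> T" for k using z[OF that] by linarith
    then have "ln (\<Prod>k\<in>T. 1 + z k) = (\<Sum>k\<in>T. ln (1 + z k))"
      using assms(1) by (intro ln_prod) (auto simp: less_imp_neq[symmetric])
    then show ?thesis by (simp add: log_def sum_divide_distrib)
  qed
  have "(\<Sum>k\<in>T. band_rate \<beta> lam (x k) (y k))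
     = (1 - lam) * (1 / 2 * log \<beta> (\<Prod>k\<in>T. 1 + x k)) + lam * (1 / 2 * log \<beta> (\<Prod>k\<in>T. 1 + y k))"
    using assms by (simp add: band_rate_def sum.distrib sum_distrib_left lg)
  also have "\<dots> \<le> band_rate \<beta> lam x' y'"
    unfolding band_rate_def using pos le lam \<beta>
    by (intro add_mono mult_left_mono) auto
  finally show ?thesis .
qed

lemma tendsto_band_rate:
  assumes "f \<longlonglongrightarrow> x" "g \<longlonglongrightarrow> y" "0 \<le> x" "0 \<le> y" "1 < \<beta>"
  shows "(\<lambda>n. band_rate \<beta> lam (f n) (g n)) \<longlonglongrightarrow> band_rate \<beta> lam x y"
  unfolding band_rate_def log_def using assms by (intro tendsto_intros) auto

text \<open>\<open>pC\<close> and \<open>p2\<close> belong to successive decoding at receiver 2,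
  common layer first. The first two claims give its constraints on the common layer alone and on
  both decoded layers; the other six are those of receiver 1 for all sets except the private layer
  alone, where equality is trivial.\<close>

lemma mac_products:
  fixes a b A C Q :: real
  assumes a: "0 < a" "a \<le> 1" and b: "1 \<le> b" "1 < a * b" and nn: "0 \<le> A" "0 \<le> C" "0 \<le> Q"
  defines "pC \<equiv> 1 + a\<^sup>2 * C / (1 + a\<^sup>2 * A + Q)" and "p2 \<equiv> 1 + Q / (1 + a\<^sup>2 * A)"
  shows "pC \<le> 1 + a\<^sup>2 * C / (1 + a\<^sup>2 * A)" "pC * p2 = 1 + (a\<^sup>2 * C + Q) / (1 + a\<^sup>2 * A)"
    "pC \<le> 1 + C" "p2 \<le> 1 + b\<^sup>2 * Q" "pC * p2 \<le> 1 + C + b\<^sup>2 * Q"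
    "(1 + A) * pC \<le> 1 + A + C" "(1 + A) * p2 \<le> 1 + A + b\<^sup>2 * Q"
    "(1 + A) * (pC * p2) \<le> 1 + A + C + b\<^sup>2 * Q"
proof -
  define N where "N = 1 + a\<^sup>2 * A"
  have N: "N \<ge> 1" using nn by (simp add: N_def)
  have a2: "a\<^sup>2 \<le> 1" using a by (simp add: power_le_one)
  have b2: "1 \<le> b\<^sup>2" using b by simp
  have "1 \<le> (a * b)\<^sup>2" using b by (intro one_le_power) auto
  then have ab2: "A \<le> a\<^sup>2 * b\<^sup>2 * A"
    using nn mult_right_mono[of 1 "(a * b)\<^sup>2" A] by (simp add: power_mult_distrib)
  \<comment> \<open>\<open>AN\<close> and \<open>CN\<close> compare the receivers with the private
    layer as noise: receiver 1 sees transmitter 2 and the common layer, respectively, at least as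
    well as receiver 2 does. Everything below follows from these two.\<close>
  have AN: "1 + A \<le> b\<^sup>2 * N"
    using b2 ab2 by (simp add: N_def algebra_simps)
  have CN: "a\<^sup>2 * (1 + A) \<le> N"
    using a2 by (simp add: N_def algebra_simps)
  show c1: "pC \<le> 1 + a\<^sup>2 * C / (1 + a\<^sup>2 * A)"
    unfolding pC_def N_def[symmetric] using N nn by (auto intro!: divide_left_mono mult_pos_pos)
  have p2N: "p2 = (N + Q) / N" and pCN: "pC = (N + Q + a\<^sup>2 * C) / (N + Q)"
    using N nn by (simp_all add: pC_def p2_def N_def[symmetric] add_divide_distrib)
  have "pC * p2 = (N + (a\<^sup>2 * C + Q)) / N"
    using N nn unfolding p2N pCN by (simp add: add_ac)
  then have eq: "pC * p2 = 1 + (a\<^sup>2 * C + Q) / N"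
    using N by (simp add: add_divide_distrib)
  then show "pC * p2 = 1 + (a\<^sup>2 * C + Q) / (1 + a\<^sup>2 * A)" by (simp add: N_def)
  have c: "(1 + A) * (a\<^sup>2 * C / N) \<le> C"
  proof -
    have "(a\<^sup>2 * (1 + A)) * C \<le> N * C" using CN nn by (intro mult_right_mono) auto
    then show ?thesis using N by (simp add: divide_le_eq mult_ac)
  qed
  have q: "(1 + A) * (Q / N) \<le> b\<^sup>2 * Q"
  proof -
    have "(1 + A) * Q \<le> (b\<^sup>2 * N) * Q" using AN nn by (intro mult_right_mono) auto
    then show ?thesis using N by (simp add: divide_le_eq mult_ac)
  qed
  have nnC: "0 \<le> a\<^sup>2 * C / N" and nnQ: "0 \<le> Q / N" using N nn by auto
  have le: "z \<le> (1 + A) * z" if "0 \<le> z" for z using nn that by (simp add: distrib_right)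
  have c0: "a\<^sup>2 * C / N \<le> C" and q0: "Q / N \<le> b\<^sup>2 * Q"
    using order_trans[OF le[OF nnC] c] order_trans[OF le[OF nnQ] q] by auto
  have pC': "pC \<le> 1 + a\<^sup>2 * C / N" using c1 by (simp add: N_def)
  have p2': "p2 = 1 + Q / N" by (simp add: p2_def N_def)
  have eq': "pC * p2 = 1 + a\<^sup>2 * C / N + Q / N" using eq by (simp add: add_divide_distrib)
  show "pC \<le> 1 + C" "p2 \<le> 1 + b\<^sup>2 * Q" "pC * p2 \<le> 1 + C + b\<^sup>2 * Q"
    using pC' c0 q0 eq' p2' by linarith+
  have "(1 + A) * pC \<le> (1 + A) * (1 + a\<^sup>2 * C / N)" using pC' nn by (intro mult_left_mono) auto
  then show "(1 + A) * pC \<le> 1 + A + C" using c by (simp only: distrib_left mult_1_right)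
  show "(1 + A) * p2 \<le> 1 + A + b\<^sup>2 * Q" using q unfolding p2' by (simp only: distrib_left mult_1_right)
  show "(1 + A) * (pC * p2) \<le> 1 + A + C + b\<^sup>2 * Q"
    using c q unfolding eq' by (simp only: distrib_left mult_1_right)
qed

text \<open>Every layer gets one rate constraint of its own, at its successive-decoding ratio; all
  joint constraints at both receivers then follow from the products. Only the private layer is
  active in the second band.\<close>

lemma achievable_three_layers:
  fixes a b A B C Q lam P1 P2 \<beta> \<eta> :: real and R :: "nat \<Rightarrow> real"
  defines "x \<equiv> (\<lambda>k::nat. if k = 0 then A else if k = 1 then a\<^sup>2 * C / (1 + a\<^sup>2 * A + Q) else Q / (1 + a\<^sup>2 * A))"
    and "y \<equiv> (\<lambda>k::nat. if k = 0 then B else 0)"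
  assumes ab: "0 < a" "a \<le> 1" "1 \<le> b" "1 < a * b"
    and nn: "0 \<le> A" "0 \<le> B" "0 \<le> C" "0 \<le> Q"
    and lam: "0 \<le> lam" "lam \<le> 1" and \<beta>: "1 < \<beta>" and \<eta>: "0 < \<eta>"
    and P1: "(1 - lam) * (A + C) + lam * B < P1" and P2: "(1 - lam) * Q < P2"
    and R: "\<And>k. 0 \<le> R k" "\<And>k. 0 < R k \<Longrightarrow> R k + \<eta> \<le> band_rate \<beta> lam (x k) (y k)"
  shows "achievable_rate_pair \<beta> a b P1 P2 (R 0 + R 1, R 2)"
proof -
  define u where "u = (\<lambda>k::nat. if k = 0 then A else if k = 1 then C else if k = 2 then Q else 1)"
  define v where "v = (\<lambda>k::nat. if k = 0 then B else if k = 1 then 0 else if k = 2 then 0 else (1::real))"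
  have den: "0 < 1 + a\<^sup>2 * A" "0 < 1 + a\<^sup>2 * A + Q" "0 < 1 + a\<^sup>2 * B" using nn by (auto simp: add_pos_nonneg)
  have xy: "0 \<le> x k" "0 \<le> y k" for k using nn den by (auto simp: x_def y_def)
  note m = mac_products[OF ab nn(1,3,4)]
  have sum_le: "(\<Sum>k\<in>T. R k) + \<eta> \<le> band_rate \<beta> lam x' y'"
    if T: "finite T" "T \<noteq> {}" "\<And>k. k \<in> T \<Longrightarrow> 0 < R k"
      and "(\<Prod>k\<in>T. 1 + x k) \<le> 1 + x'" "(\<Prod>k\<in>T. 1 + y k) \<le> 1 + y'" for T x' y'
  proof -
    obtain k0 where "k0 \<in> T" using T(2) by auto
    \<comment> \<open>Each layer brings its own slack \<open>\<eta>\<close>; as \<open>T\<close> is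
      nonempty, at least one is available.\<close>
    have "(\<Sum>k\<in>T. R k) + \<eta> \<le> (\<Sum>k\<in>T. R k + \<eta>)"
      using \<open>k0 \<in> T\<close> T(1) \<eta> member_le_sum[of k0 T "\<lambda>_. \<eta>"] by (simp add: sum.distrib)
    also have "\<dots> \<le> (\<Sum>k\<in>T. band_rate \<beta> lam (x k) (y k))"
      using R(2) T(3) by (intro sum_mono) auto
    also have "\<dots> \<le> band_rate \<beta> lam x' y'"
      using that xy by (intro sum_band_rate_le lam \<beta>) auto
    finally show ?thesis .
  qed
  show ?thesis
  proof (rule achievable_of_rates[where u = u and v = v and lam = lam and \<eta> = \<eta>])
    fix T :: "nat set" assume T: "T \<subseteq> {0, 1, 2}" "T \<noteq> {}" "\<And>k. k \<in> T \<Longrightarrow> 0 < R k"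
    have fin: "finite T" using T(1) by (rule finite_subset) simp
    have cases: "T \<in> {{0}, {1}, {2}, {0, 1}, {0, 2}, {1, 2}, {0, 1, 2}}"
    proof -
      have "T \<in> Pow {0, 1, 2}" using T(1) by simp
      then show ?thesis using T(2) by (simp add: Pow_insert insert_commute)
    qed
    show "(\<Sum>k\<in>T. R k) + \<eta> \<le> band_rate \<beta> lam
       (received (\<lambda>k. if k = 2 then b else 1) u T / received (\<lambda>k. if k = 2 then b else 1) u {3})
       (received (\<lambda>k. if k = 2 then b else 1) v T / received (\<lambda>k. if k = 2 then b else 1) v {3})"
      by (rule sum_le[OF fin T(2,3)])
         (use cases m nn in \<open>auto simp: x_def y_def u_def v_def received_def mult.assoc add.assoc\<close>)
  next
    fix T :: "nat set" assume T: "T \<subseteq> {1, 2}" "T \<noteq> {}" "\<And>k. k \<in> T \<Longrightarrow> 0 < R k"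
    have fin: "finite T" using T(1) by (rule finite_subset) simp
    have cases: "T \<in> {{1}, {2}, {1, 2}}"
    proof -
      have "T \<in> Pow {1, 2}" using T(1) by simp
      then show ?thesis using T(2) by (simp add: Pow_insert insert_commute)
    qed
    show "(\<Sum>k\<in>T. R k) + \<eta> \<le> band_rate \<beta> lam
       (received (\<lambda>k. if k < 2 then a else 1) u T / received (\<lambda>k. if k < 2 then a else 1) u {0, 3})
       (received (\<lambda>k. if k < 2 then a else 1) v T / received (\<lambda>k. if k < 2 then a else 1) v {0, 3})"
      by (rule sum_le[OF fin T(2,3)])
         (use cases m nn in \<open>auto simp: x_def y_def u_def v_def received_def add.commute\<close>)
  qed (use nn lam \<beta> \<eta> P1 P2 R(1) in \<open>auto simp: u_def v_def\<close>)
qed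

text \<open>The point is a limit of achievable pairs: multiplying all powers by
  \<open>1 - \<eta>\<close> makes the power constraints strict, and the rates depend continuously on
  the powers.\<close>

lemma noiseberg_point_in_capacity_region:
  fixes a b A B C Q lam P1 P2 \<beta> R1 R2 :: real
  assumes ab: "0 < a" "a \<le> 1" "1 \<le> b" "1 < a * b"
    and nn: "0 \<le> A" "0 \<le> B" "0 \<le> C" "0 \<le> Q"
    and lam: "0 \<le> lam" "lam \<le> 1" and \<beta>: "1 < \<beta>" and P: "0 < P1" "0 < P2"
    and P1: "(1 - lam) * (A + C) + lam * B = P1" and P2: "(1 - lam) * Q = P2"
    and R: "0 \<le> R1" "0 \<le> R2"
    and R1: "R1 \<le> band_rate \<beta> lam A B + band_rate \<beta> lam (a\<^sup>2 * C / (1 + a\<^sup>2 * A + Q)) 0"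
    and R2: "R2 \<le> band_rate \<beta> lam (Q / (1 + a\<^sup>2 * A)) 0"
  shows "(R1, R2) \<in> capacity_region \<beta> a b P1 P2"
proof -
  define x where "x c = (\<lambda>k::nat. if k = 0 then c * A else if k = 1 then a\<^sup>2 * (c * C) / (1 + a\<^sup>2 * (c * A) + c * Q)
      else c * Q / (1 + a\<^sup>2 * (c * A)))" for c
  define y where "y c = (\<lambda>k::nat. if k = 0 then c * B else 0)" for c
  define X where "X c k = band_rate \<beta> lam (x c k) (y c k)" for c k
  \<comment> \<open>The private layer is filled first; the remainder of \<open>R1\<close> fits into
    the common layer because \<open>R1 \<le> X 1 0 + X 1 1\<close>.\<close>
  define Rt where "Rt = (\<lambda>k::nat. if k = 0 then min R1 (X 1 0) else if k = 1 then R1 - min R1 (X 1 0) else R2)"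
  have den: "1 + a\<^sup>2 * A > 0" "1 + a\<^sup>2 * A + Q > 0" using nn by (auto simp: add_pos_nonneg)
  have xy: "0 \<le> x 1 k" "0 \<le> y 1 k" for k using nn den by (auto simp: x_def y_def)
  have br: "0 \<le> band_rate \<beta> lam p q" if "0 \<le> p" "0 \<le> q" for p q
    unfolding band_rate_def using that lam \<beta> by (intro add_nonneg_nonneg mult_nonneg_nonneg) auto
  have Rt: "0 \<le> Rt k" "Rt k \<le> X 1 k" for k
  proof -
    have "0 \<le> X 1 0" unfolding X_def using xy by (rule br)
    moreover have "0 \<le> X 1 1" unfolding X_def using xy by (rule br)
    moreover have "R1 \<le> X 1 0 + X 1 1" using R1 by (simp add: X_def x_def y_def)
    moreover have "k \<noteq> 0 \<Longrightarrow> k \<noteq> 1 \<Longrightarrow> R2 \<le> X 1 k" using R2 by (simp add: X_def x_def y_def)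
    ultimately show "0 \<le> Rt k" "Rt k \<le> X 1 k"
      using R by (cases "k = 0"; cases "k = 1"; simp add: Rt_def min_def)+
  qed
  \<comment> \<open>Starting at 1/2 keeps the scaling factor \<open>1 - \<eta> n\<close>
    positive.\<close>
  define \<eta> where "\<eta> n = inverse (real (Suc (Suc n)))" for n
  have \<eta>: "0 < \<eta> n" "\<eta> n < 1" for n
    unfolding \<eta>_def by (auto simp: inverse_less_1_iff)
  have \<eta>0: "\<eta> \<longlonglongrightarrow> 0"
    unfolding \<eta>_def using LIMSEQ_Suc[OF LIMSEQ_inverse_real_of_nat] .
  have c1: "(\<lambda>n. 1 - \<eta> n) \<longlonglongrightarrow> 1" using tendsto_diff[OF tendsto_const \<eta>0, of 1] by simp
  have x1: "(\<lambda>n. x (1 - \<eta> n) k) \<longlonglongrightarrow> x 1 k" for k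
  proof -
    have "(\<lambda>n. (1 - \<eta> n) * A) \<longlonglongrightarrow> 1 * A"
      "(\<lambda>n. a\<^sup>2 * ((1 - \<eta> n) * C) / (1 + a\<^sup>2 * ((1 - \<eta> n) * A) + (1 - \<eta> n) * Q)) \<longlonglongrightarrow> a\<^sup>2 * (1 * C) / (1 + a\<^sup>2 * (1 * A) + 1 * Q)"
      "(\<lambda>n. (1 - \<eta> n) * Q / (1 + a\<^sup>2 * ((1 - \<eta> n) * A))) \<longlonglongrightarrow> 1 * Q / (1 + a\<^sup>2 * (1 * A))"
      using den by (intro tendsto_intros c1; simp)+
    then show ?thesis by (simp add: x_def)
  qed
  have y1: "(\<lambda>n. y (1 - \<eta> n) k) \<longlonglongrightarrow> y 1 k" for k
  proof -
    have "(\<lambda>n. (1 - \<eta> n) * B) \<longlonglongrightarrow> 1 * B" by (intro tendsto_intros c1)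
    then show ?thesis by (simp add: y_def)
  qed
  have X1: "(\<lambda>n. X (1 - \<eta> n) k) \<longlonglongrightarrow> X 1 k" for k
    unfolding X_def using xy by (intro tendsto_band_rate x1 y1 \<beta>)
  \<comment> \<open>A positive value lies at least \<open>\<eta> n\<close> below the rate available
    at reduced power. When \<open>max\<close> returns 0 the layer has rate 0 and no slack is
    demanded of it.\<close>
  define S where "S n k = max 0 (min (Rt k) (X (1 - \<eta> n) k) - \<eta> n)" for n k
  have S: "(\<lambda>n. S n k) \<longlonglongrightarrow> Rt k" for k
  proof -
    have "(\<lambda>n. S n k) \<longlonglongrightarrow> max 0 (min (Rt k) (X 1 k) - 0)"
      unfolding S_def by (intro tendsto_intros X1 \<eta>0)
    then show ?thesis using Rt[of k] by (simp add: min_def)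
  qed
  have "achievable_rate_pair \<beta> a b P1 P2 (S n 0 + S n 1, S n 2)" for n
  proof (rule achievable_three_layers[where A = "(1 - \<eta> n) * A" and B = "(1 - \<eta> n) * B" and C = "(1 - \<eta> n) * C"
        and Q = "(1 - \<eta> n) * Q" and \<eta> = "\<eta> n" and lam = lam])
    have "(1 - lam) * ((1 - \<eta> n) * A + (1 - \<eta> n) * C) + lam * ((1 - \<eta> n) * B) = (1 - \<eta> n) * P1"
      unfolding P1[symmetric] by (simp add: algebra_simps)
    also have "\<dots> < P1" using \<eta>[of n] P by simp
    finally show "(1 - lam) * ((1 - \<eta> n) * A + (1 - \<eta> n) * C) + lam * ((1 - \<eta> n) * B) < P1" .
    have "(1 - lam) * ((1 - \<eta> n) * Q) = (1 - \<eta> n) * P2"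
      unfolding P2[symmetric] by (simp add: algebra_simps)
    also have "\<dots> < P2" using \<eta>[of n] P by simp
    finally show "(1 - lam) * ((1 - \<eta> n) * Q) < P2" .
    show "0 \<le> S n k" for k by (simp add: S_def)
    fix k assume "0 < S n k"
    then have "S n k + \<eta> n \<le> X (1 - \<eta> n) k" unfolding S_def by linarith
    then show "S n k + \<eta> n \<le> band_rate \<beta> lam
        (if k = 0 then (1 - \<eta> n) * A
         else if k = 1 then a\<^sup>2 * ((1 - \<eta> n) * C) / (1 + a\<^sup>2 * ((1 - \<eta> n) * A) + (1 - \<eta> n) * Q)
         else (1 - \<eta> n) * Q / (1 + a\<^sup>2 * ((1 - \<eta> n) * A)))
        (if k = 0 then (1 - \<eta> n) * B else 0)"
      unfolding X_def x_def y_def .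
  qed (use ab nn lam \<beta> \<eta>[of n] in auto)
  moreover have "(\<lambda>n. (S n 0 + S n 1, S n 2)) \<longlonglongrightarrow> (R1, R2)"
  proof -
    have "Rt 0 + Rt 1 = R1" "Rt 2 = R2" by (auto simp: Rt_def)
    then show ?thesis
      using tendsto_Pair[OF tendsto_add[OF S[of 0] S[of 1]] S[of 2]] by simp
  qed
  ultimately show ?thesis
    unfolding capacity_region_def closure_sequential mem_Collect_eq by (intro exI[of _ "\<lambda>n. (S n 0 + S n 1, S n 2)"]) blast
qed

theorem theorem2:
  fixes a b P1 P2 \<beta> :: real
  assumes "0 < a" and "a \<le> 1"
    and "1 \<le> b" and "1 < a * b"
    and "0 < P1" and "0 < P2"
    and "1 < \<beta>"
  shows "achievable_region \<beta> a b P1 P2 (noiseberg_region \<beta> a P1 P2)"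
  unfolding achievable_region_def
proof
  fix p assume "p \<in> noiseberg_region \<beta> a P1 P2"
  then obtain R1 R2 lam h r1 r2 s1 where p: "p = (R1, R2)"
    and R: "0 \<le> R1" "0 \<le> R2" and adm: "noiseberg_admissible a P1 P2 lam h"
    and R1: "R1 \<le> (1 - lam) * r1 + lam * s1" and R2: "R2 \<le> (1 - lam) * r2"
    and r1: "r1 \<le> 1/2 * log \<beta> (1 + dens_A a P1 P2 lam h)
                + 1/2 * log \<beta> (1 + a\<^sup>2 * dens_C a h / (1 + a\<^sup>2 * dens_A a P1 P2 lam h + P2 / (1 - lam)))"
    and r2: "r2 \<le> 1/2 * log \<beta> (1 + (P2 / (1 - lam)) / (1 + a\<^sup>2 * dens_A a P1 P2 lam h))"
    and s1: "s1 \<le> 1/2 * log \<beta> (1 + dens_B a P1 P2 lam h)"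
    unfolding noiseberg_region_def by auto
  define A B C Q where "A = dens_A a P1 P2 lam h" and "B = dens_B a P1 P2 lam h"
    and "C = dens_C a h" and "Q = P2 / (1 - lam)"
  note fold = A_def[symmetric] B_def[symmetric] C_def[symmetric] Q_def[symmetric]
  have lam: "0 \<le> lam" "lam < 1" "0 \<le> h" and A: "0 \<le> A"
    using adm by (auto simp: noiseberg_admissible_def A_def zero_le_mult_iff)
  have "0 \<le> (1 - a\<^sup>2) / a\<^sup>2" using assms(1,2) by (simp add: power_le_one)
  then have B: "0 \<le> B"
    unfolding B_def dens_B_def using assms lam by (intro add_nonneg_nonneg mult_nonneg_nonneg) auto
  have C: "0 \<le> C" by (simp add: C_def dens_C_def)
  have Q: "0 \<le> Q" "(1 - lam) * Q = P2" using assms lam by (auto simp: Q_def)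
  have P1: "(1 - lam) * (A + C) + lam * B = P1"
    using noiseberg_total_power[of a lam P1 P2 h] assms lam unfolding fold by (simp add: algebra_simps)
  have "R1 \<le> (1 - lam) * (1/2 * log \<beta> (1 + A) + 1/2 * log \<beta> (1 + a\<^sup>2 * C / (1 + a\<^sup>2 * A + Q)))
      + lam * (1/2 * log \<beta> (1 + B))"
    using r1 s1 lam unfolding fold by (intro order_trans[OF R1] add_mono mult_left_mono) auto
  \<comment> \<open>Regrouping by layers instead of bands: the second-band rate joins the private
    rate of the first band, and the common layer has ratio 0 in the second.\<close>
  then have "R1 \<le> band_rate \<beta> lam A B + band_rate \<beta> lam (a\<^sup>2 * C / (1 + a\<^sup>2 * A + Q)) 0"
    by (simp add: band_rate_def algebra_simps)
  moreover have "R2 \<le> (1 - lam) * (1/2 * log \<beta> (1 + Q / (1 + a\<^sup>2 * A)))"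
    using r2 lam unfolding fold by (intro order_trans[OF R2] mult_left_mono) auto
  then have "R2 \<le> band_rate \<beta> lam (Q / (1 + a\<^sup>2 * A)) 0"
    by (simp add: band_rate_def)
  ultimately show "p \<in> capacity_region \<beta> a b P1 P2"
    unfolding p using assms lam A B C Q P1 R
    by (intro noiseberg_point_in_capacity_region[where A = A and B = B and C = C and Q = Q and lam = lam]) auto
qed

end
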